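(* Let $\Phi\in\mathrm{Mat}_{\ell\times\ell}(\bar k[t])$ be such that $\det\Phi$ is a polynomial in $t$ vanishing (if at all) only at $t=T$. Let $\psi\in\mathrm{Mat}_{\ell\times1}(\mathcal E)$ satisfy $\psi^{(-1)}=\Phi\psi$. Then for every row vector $\rho\in\mathrm{Mat}_{1\times\ell}(\bar k)$ with $\rho\,\psi(T)=0$ there exists $P\in\mathrm{Mat}_{1\times\ell}(\bar k[t])$ with $P(T)=\rho$ and $P\psi=0$.
   Context: Notation: $A=\mathbb F_q[T]$, $k=\mathbb F_q(T)$, $|\cdot|_\infty$ the absolute value with $|T|_\infty=q$, $k_\infty=\mathbb F_q((1/T))$, $\overline{k_\infty}$ an algebraic closure, $\mathbb C_\infty$ its completion, $\bar k$ the algebraic closure of $k$ in $\mathbb C_\infty$; $t$ is a variable independent of $T$. Twisting: for $n\in\mathbb Z$ and $g=\sum_i a_it^i\in\mathbb C_\infty[[t]]$, $g^{(n)}=\sum_i a_i^{q^n}t^i$, applied entrywise to matrices. $\mathcal E$ is the ring of power series $\sum_{n\ge0}a_nt^n\in\bar k[[t]]$ such that $\lim_{n\to\infty}|a_n|_\infty^{1/n}=0$ and $[k_\infty(a_0,a_1,\dots):k_\infty]<\infty$; such series are entire, and $\psi(T)\in\mathrm{Mat}_{\ell\times1}(\overline{k_\infty})$ denotes evaluation at $t=T$. *)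

theory Defs
  imports "HOL-Analysis.Analysis" "HOL-Computational_Algebra.Polynomial_FPS"
begin

text \<open>The ambient field C (playing the role of C_infinity) is an arbitrary field type 'a
  equipped with an absolute value nv; q is the size of the constant field, T the element T.\<close>

definition Fq :: "nat \<Rightarrow> 'a::field set" where
  "Fq q = {x. x ^ q = x}"

definition kfield :: "nat \<Rightarrow> 'a::field \<Rightarrow> 'a set" where
  "kfield q T = {poly f T / poly g T | f g.
      (\<forall>i. coeff f i \<in> Fq q) \<and> (\<forall>i. coeff g i \<in> Fq q) \<and> poly g T \<noteq> 0}"

definition kinf :: "nat \<Rightarrow> 'a::field \<Rightarrow> ('a \<Rightarrow> real) \<Rightarrow> 'a set" where
  "kinf q T nv = {x. \<forall>e>0. \<exists>y\<in>kfield q T. nv (x - y) < e}"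

definition algebraic_over :: "'a::field set \<Rightarrow> 'a \<Rightarrow> bool" where
  "algebraic_over K x \<longleftrightarrow> (\<exists>p. p \<noteq> 0 \<and> (\<forall>i. coeff p i \<in> K) \<and> poly p x = 0)"

definition kbar :: "nat \<Rightarrow> 'a::field \<Rightarrow> 'a set" where
  "kbar q T = {x. algebraic_over (kfield q T) x}"

definition is_subfield :: "'a::field set \<Rightarrow> bool" where
  "is_subfield S \<longleftrightarrow> 0 \<in> S \<and> 1 \<in> S \<and> (\<forall>x\<in>S. \<forall>y\<in>S. x + y \<in> S \<and> x * y \<in> S)
     \<and> (\<forall>x\<in>S. - x \<in> S \<and> inverse x \<in> S)"

definition gen_field :: "'a::field set \<Rightarrow> 'a set \<Rightarrow> 'a set" where
  "gen_field K X = \<Inter>{S. is_subfield S \<and> K \<union> X \<subseteq> S}"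

definition finite_degree :: "'a::field set \<Rightarrow> 'a set \<Rightarrow> bool" where
  "finite_degree K L \<longleftrightarrow>
     (\<exists>B. finite B \<and> L \<subseteq> {\<Sum>b\<in>B. c b * b | c. \<forall>b\<in>B. c b \<in> K})"

definition in_E :: "nat \<Rightarrow> 'a::field \<Rightarrow> ('a \<Rightarrow> real) \<Rightarrow> 'a fps \<Rightarrow> bool" where
  "in_E q T nv f \<longleftrightarrow>
     (\<forall>n. fps_nth f n \<in> kbar q T)
     \<and> ((\<lambda>n. nv (fps_nth f n) powr (1 / real n)) \<longlonglongrightarrow> 0)
     \<and> finite_degree (kinf q T nv) (gen_field (kinf q T nv) (range (fps_nth f)))"

definition series_eval :: "('a::field \<Rightarrow> real) \<Rightarrow> 'a fps \<Rightarrow> 'a \<Rightarrow> 'a" where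
  "series_eval nv f x =
     (THE s. (\<lambda>N. nv (s - (\<Sum>n<N. fps_nth f n * x ^ n))) \<longlonglongrightarrow> 0)"

definition frob_inv :: "nat \<Rightarrow> 'a::field \<Rightarrow> 'a" where
  "frob_inv q x = (THE y. y ^ q = x)"

definition twist_inv :: "nat \<Rightarrow> 'a::field fps \<Rightarrow> 'a fps" where
  "twist_inv q f = Abs_fps (\<lambda>n. frob_inv q (fps_nth f n))"

end

theory Submission
  imports Defs
begin

text \<open>Applying \<open>q\<close>-th roots to \<open>\<rho>\<psi>(T) = 0\<close> and using the functional equation yields, at the iterated
  \<open>q\<close>-th root \<open>\<tau>\<^sub>v\<close> of \<open>T\<close> for each \<open>v\<close>, a linear relation with coefficient row \<open>r\<^sub>v\<close> among the values \<open>\<psi>(\<tau>\<^sub>v)\<close>.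
  By Siegel's lemma there is a nonzero row \<open>P\<close> of polynomials of small size and degree less than
  \<open>(2l - 1)s\<close> such that \<open>P(\<tau>\<^sub>v)\<close> is proportional to \<open>r\<^sub>v\<close> for all \<open>v < 2ls\<close>, so that \<open>E = P\<psi>\<close> vanishes
  at these points. If \<open>E \<noteq> 0\<close>, Schwarz' lemma on a large disc makes its lowest coefficient
  very small. On the other hand \<open>E\<close> and its first \<open>l\<close> inverse twists are linearly dependent over
  polynomials of controlled size, so this coefficient is a root of an additive
  polynomial, and Liouville's inequality bounds it from below; for large \<open>s\<close> this is a contradiction.
  Hence \<open>P\<psi> = 0\<close>, and since \<open>P\<close> has fewer than \<open>2ls\<close> zeros, \<open>P(\<tau>\<^sub>v)\<close> is a nonzero multiple of \<open>r\<^sub>v\<close>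
  for some \<open>v\<close>. Multiplying by the adjugate of \<open>\<Phi>\<close> and twisting moves this back from \<open>\<tau>\<^sub>v\<close>
  to \<open>\<tau>\<^sub>0 = T\<close>, because the determinant of \<open>\<Phi>\<close> vanishes at none of \<open>\<tau>\<^sub>1, \<tau>\<^sub>2, \<dots>\<close>.\<close>

section \<open>Subfields, linear systems and adjugates\<close>

text \<open>Evaluated at a \<open>q\<close>-th root of a point, the functional equation transports a
  relation from the point to the root by multiplication with \<open>\<Phi>\<close>, so nothing has
  to be inverted on the way out. All \<open>\<tau> v\<close> lie in the disc of radius
  \<open>q\<close>; arbitrarily many zeros of \<open>E\<close> therefore fit into a fixed disc. With
  \<open>2ls\<close> zeros against a degree below \<open>(2l - 1)s\<close>, Schwarz' lemma at radius
  \<open>R\<close> leaves a net gain \<open>R ^ s\<close>, while every size that enters is at most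
  \<open>q\<close> to a power linear in \<open>s\<close>. A fixed large \<open>R\<close> is thus
  enough, and it must be chosen before \<open>s\<close>, because the bound for \<open>\<psi>\<close>
  depends on \<open>R\<close>. The obstacle is the lower bound. The coefficients of
  \<open>\<psi>\<close> have no controlled size, so Liouville's inequality cannot be applied to a
  coefficient of \<open>E\<close>. It is applied to the coefficients of a polynomial relation among
  the twists of \<open>E\<close>, whose size depends neither on the degree of \<open>P\<close> nor
  on the vanishing order of \<open>E\<close> at 0.\<close>

definition polys_over :: "'a::field set \<Rightarrow> 'a poly set" where
  "polys_over S = {f. \<forall>i. coeff f i \<in> S}"

lemma is_subfieldD:
  assumes "is_subfield S"
  shows "0 \<in> S" "1 \<in> S" "\<And>x y. x \<in> S \<Longrightarrow> y \<in> S \<Longrightarrow> x + y \<in> S"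
    "\<And>x y. x \<in> S \<Longrightarrow> y \<in> S \<Longrightarrow> x * y \<in> S" "\<And>x. x \<in> S \<Longrightarrow> - x \<in> S"
    "\<And>x. x \<in> S \<Longrightarrow> inverse x \<in> S"
  using assms unfolding is_subfield_def by blast+

lemma subfield_closed:
  assumes "is_subfield S"
  shows "\<And>x y. x \<in> S \<Longrightarrow> y \<in> S \<Longrightarrow> x - y \<in> S" "\<And>x y. x \<in> S \<Longrightarrow> y \<in> S \<Longrightarrow> x / y \<in> S"
    "\<And>x n. x \<in> S \<Longrightarrow> x ^ n \<in> S"
    "\<And>f A. (\<And>i. i \<in> A \<Longrightarrow> f i \<in> S) \<Longrightarrow> sum f A \<in> S"
proof -
  note s = is_subfieldD[OF assms]
  show "x - y \<in> S" if "x \<in> S" "y \<in> S" for x y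
    using s(3)[OF that(1) s(5)[OF that(2)]] by simp
  show "x / y \<in> S" if "x \<in> S" "y \<in> S" for x y
    using s(4)[OF that(1) s(6)[OF that(2)]] by (simp add: divide_inverse)
  show "x ^ n \<in> S" if "x \<in> S" for x n
    by (induction n) (use s that in auto)
  show "sum f A \<in> S" if "\<And>i. i \<in> A \<Longrightarrow> f i \<in> S" for f and A :: "'b set"
    using that by (induction A rule: infinite_finite_induct) (use s in auto)
qed

lemma polys_over_closed:
  assumes "is_subfield S"
  shows "0 \<in> polys_over S" "1 \<in> polys_over S"
    "\<And>f g. f \<in> polys_over S \<Longrightarrow> g \<in> polys_over S \<Longrightarrow> f + g \<in> polys_over S"
    "\<And>f g. f \<in> polys_over S \<Longrightarrow> g \<in> polys_over S \<Longrightarrow> f * g \<in> polys_over S"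
    "\<And>f. f \<in> polys_over S \<Longrightarrow> - f \<in> polys_over S"
    "\<And>c f. c \<in> S \<Longrightarrow> f \<in> polys_over S \<Longrightarrow> smult c f \<in> polys_over S"
    "\<And>f (A :: 'b set). (\<And>i. i \<in> A \<Longrightarrow> f i \<in> polys_over S) \<Longrightarrow> sum f A \<in> polys_over S"
    "\<And>f (A :: 'c set). (\<And>i. i \<in> A \<Longrightarrow> f i \<in> polys_over S) \<Longrightarrow> prod f A \<in> polys_over S"
    "\<And>f x. f \<in> polys_over S \<Longrightarrow> x \<in> S \<Longrightarrow> poly f x \<in> S"
    "\<And>c. c \<in> S \<Longrightarrow> [:c:] \<in> polys_over S"
    "\<And>c n. c \<in> S \<Longrightarrow> monom c n \<in> polys_over S"
proof -
  note s = is_subfieldD[OF assms] subfield_closed[OF assms]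
  show 0: "0 \<in> polys_over S" and 1: "1 \<in> polys_over S"
    using s by (auto simp: polys_over_def coeff_1)
  show a: "f + g \<in> polys_over S" if "f \<in> polys_over S" "g \<in> polys_over S" for f g
    using that s by (auto simp: polys_over_def)
  show m: "f * g \<in> polys_over S" if "f \<in> polys_over S" "g \<in> polys_over S" for f g
    using that s by (auto simp: polys_over_def coeff_mult intro!: s(10))
  show "- f \<in> polys_over S" if "f \<in> polys_over S" for f
    using that s by (auto simp: polys_over_def)
  show "smult c f \<in> polys_over S" if "c \<in> S" "f \<in> polys_over S" for c f
    using that s by (auto simp: polys_over_def)
  show "sum f A \<in> polys_over S" if "\<And>i. i \<in> A \<Longrightarrow> f i \<in> polys_over S" for f and A :: "'b set"
    using that by (induction A rule: infinite_finite_induct) (use 0 a in auto)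
  show "prod f A \<in> polys_over S" if "\<And>i. i \<in> A \<Longrightarrow> f i \<in> polys_over S" for f and A :: "'c set"
    using that by (induction A rule: infinite_finite_induct) (use 1 m in auto)
  show "poly f x \<in> S" if "f \<in> polys_over S" "x \<in> S" for f x
    using that by (auto simp: polys_over_def poly_altdef intro!: s)
  show "[:c:] \<in> polys_over S" if "c \<in> S" for c
    using that s by (auto simp: polys_over_def coeff_pCons split: nat.split)
  show "monom c n \<in> polys_over S" if "c \<in> S" for c n
    using that s by (auto simp: polys_over_def)
qed

lemma polys_over_pcompose:
  assumes S: "is_subfield S" and "f \<in> polys_over S" "g \<in> polys_over S"
  shows "pcompose f g \<in> polys_over S"
  using assms(2)
proof (induction f)
  case 0
  then show ?case by simp
next
  case (pCons a f)
  then have *: "a \<in> S" "f \<in> polys_over S"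
    by (auto simp: polys_over_def coeff_pCons split: nat.splits)
  show ?case unfolding pcompose_pCons
    by (intro polys_over_closed[OF S] assms * pCons.IH)
qed

text \<open>Neither factor on the right has to be nonzero, so one pair of indices serves all terms
  of a sum of such products at once.\<close>

lemma nth_fps_of_poly_mult_lowest:
  assumes "\<And>k. k < k0 \<Longrightarrow> coeff P k = 0" "\<And>n. n < m \<Longrightarrow> fps_nth F n = (0 :: 'a :: comm_ring_1)"
  shows "fps_nth (fps_of_poly P * F) (k0 + m) = coeff P k0 * fps_nth F m"
proof -
  have "fps_nth (fps_of_poly P * F) (k0 + m)
      = (\<Sum>t\<in>{0..k0 + m}. coeff P t * fps_nth F (k0 + m - t))" by (simp add: fps_mult_nth)
  also have "\<dots> = (\<Sum>t\<in>{k0}. coeff P t * fps_nth F (k0 + m - t))"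
  proof (rule sum.mono_neutral_right)
    show "\<forall>t\<in>{0..k0 + m} - {k0}. coeff P t * fps_nth F (k0 + m - t) = 0"
    proof
      fix t assume t: "t \<in> {0..k0 + m} - {k0}"
      then consider "t < k0" | "k0 + m - t < m" by fastforce
      then show "coeff P t * fps_nth F (k0 + m - t) = 0" by cases (auto simp: assms)
    qed
  qed auto
  finally show ?thesis by simp
qed

text \<open>Eliminating one equation with one pivot variable never leaves \<open>F\<close>. Over the
  constants this yields Siegel's lemma, over \<open>kfield\<close> it yields algebraicity.\<close>

lemma ex_nontrivial_solution:
  fixes F :: "'a::field set" and a :: "'i \<Rightarrow> 'j \<Rightarrow> 'a"
  assumes F: "is_subfield F" and "finite I" "finite J" "card I < card J"
    and "\<And>i j. i \<in> I \<Longrightarrow> j \<in> J \<Longrightarrow> a i j \<in> F"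
  shows "\<exists>y. (\<forall>j\<in>J. y j \<in> F) \<and> (\<exists>j\<in>J. y j \<noteq> 0) \<and> (\<forall>i\<in>I. (\<Sum>j\<in>J. a i j * y j) = 0)"
  using assms(2-)
proof (induction I arbitrary: J a rule: finite_induct)
  case empty
  then have "J \<noteq> {}" by auto
  then show ?case using is_subfieldD[OF F] by (intro exI[of _ "\<lambda>_. 1"]) auto
next
  case (insert i I)
  note s = is_subfieldD[OF F] subfield_closed[OF F]
  show ?case
  proof (cases "\<forall>j\<in>J. a i j = 0")
    case True
    have "card I < card J" using insert by simp
    from insert.IH[OF \<open>finite J\<close> this, of a] insert.prems obtain y
      where "\<forall>j\<in>J. y j \<in> F" "\<exists>j\<in>J. y j \<noteq> 0" "\<forall>i\<in>I. (\<Sum>j\<in>J. a i j * y j) = 0"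
      by auto
    with True show ?thesis by (intro exI[of _ y]) auto
  next
    case False
    then obtain j0 where j0: "j0 \<in> J" "a i j0 \<noteq> 0" by auto
    let ?J = "J - {j0}"
    define b where "b i' j = a i' j - a i' j0 * a i j / a i j0" for i' j
    have "card I < card ?J" using insert j0 by simp
    moreover have "b i' j \<in> F" if "i' \<in> I" "j \<in> ?J" for i' j
      unfolding b_def using that insert.prems j0 by (intro s) auto
    ultimately obtain y where y: "\<forall>j\<in>?J. y j \<in> F" "\<exists>j\<in>?J. y j \<noteq> 0"
        "\<forall>i'\<in>I. (\<Sum>j\<in>?J. b i' j * y j) = 0"
      using insert.IH[of ?J b] insert.prems by auto
    \<comment> \<open>Back substitution: equation \<open>i\<close> determines the pivot
      variable.\<close>
    define z where "z j = (if j = j0 then - (\<Sum>j\<in>?J. a i j * y j) / a i j0 else y j)" for j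
    have split: "(\<Sum>j\<in>J. f j * z j) = f j0 * z j0 + (\<Sum>j\<in>?J. f j * y j)" for f
    proof -
      have "(\<Sum>j\<in>?J. f j * z j) = (\<Sum>j\<in>?J. f j * y j)"
        by (intro sum.cong) (auto simp: z_def)
      then show ?thesis
        using sum.remove[OF \<open>finite J\<close> j0(1), of "\<lambda>j. f j * z j"] by simp
    qed
    show ?thesis
    proof (intro exI[of _ z] conjI ballI)
      fix j assume "j \<in> J"
      then show "z j \<in> F" unfolding z_def using y(1) insert.prems j0 by (auto intro!: s)
    next
      show "\<exists>j\<in>J. z j \<noteq> 0" using y(2) by (auto simp: z_def)
    next
      fix i' assume "i' \<in> insert i I"
      show "(\<Sum>j\<in>J. a i' j * z j) = 0"
      proof (cases "i' = i")
        case True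
        then show ?thesis using j0 unfolding split by (simp add: z_def)
      next
        case False
        with \<open>i' \<in> insert i I\<close> y(3) have "(\<Sum>j\<in>?J. b i' j * y j) = 0" by auto
        then have "(\<Sum>j\<in>?J. a i' j * y j) = (\<Sum>j\<in>?J. a i' j0 / a i j0 * (a i j * y j))"
          unfolding b_def by (simp add: algebra_simps sum_subtractf)
        also have "\<dots> = a i' j0 / a i j0 * (\<Sum>j\<in>?J. a i j * y j)"
          by (simp add: sum_distrib_left)
        finally show ?thesis unfolding split by (simp add: z_def)
      qed
    qed
  qed
qed

text \<open>Cofactors as determinants with one row replaced by a unit row: expansion along a row
  becomes linearity of \<open>det\<close> in that row.\<close>

definition adjugate :: "'b::comm_ring_1^'n^'n \<Rightarrow> 'b^'n^'n" where
  "adjugate A = (\<chi> j i. det (\<chi> a. if a = i then axis j 1 else row a A))"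

lemma matrix_mul_adjugate: "A ** adjugate A = mat (det A)"
proof -
  have "(A ** adjugate A) $ k $ i = mat (det A) $ k $ i" for k i
  proof -
    have "(A ** adjugate A) $ k $ i
        = (\<Sum>j\<in>UNIV. det (\<chi> a. if a = i then A$k$j *s axis j 1 else row a A))"
      by (simp add: matrix_matrix_mult_def adjugate_def det_row_mul)
    also have "\<dots> = det (\<chi> a. if a = i then (\<Sum>j\<in>UNIV. A$k$j *s axis j 1) else row a A)"
      by (rule det_linear_row_sum[OF finite, of i "\<lambda>i j. A$k$j *s axis j 1", symmetric])
    also have "(\<Sum>j\<in>UNIV. A$k$j *s axis j 1) = row k A"
      unfolding row_def by (simp add: vec_eq_iff axis_def if_distrib[of "\<lambda>x. _ * x"] cong: if_cong)
    also have "det (\<chi> a. if a = i then row k A else row a A) = (if k = i then det A else 0)"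
    proof (cases "k = i")
      case True
      then have "(\<chi> a. if a = i then row k A else row a A) = A"
        by (simp add: vec_eq_iff row_def)
      then show ?thesis using True by simp
    next
      case False
      show ?thesis
        using False det_identical_rows[of k i "\<chi> a. if a = i then row k A else row a A"]
        by (simp add: row_def)
    qed
    finally show ?thesis by (simp add: mat_def)
  qed
  then show ?thesis by (simp add: vec_eq_iff)
qed

text \<open>The previous identity for the transpose gives a left counterpart \<open>Y\<close>;
  associativity identifies \<open>Y\<close> with the adjugate once \<open>det A\<close> can be
  cancelled.\<close>

lemma adjugate_matrix_mul:
  fixes A :: "'b::idom^'n^'n"
  assumes "det A \<noteq> 0"
  shows "adjugate A ** A = mat (det A)"
proof -
  have tm: "transpose (mat d) = mat d" for d :: 'b
    by (simp add: transpose_def mat_def vec_eq_iff)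
  have ml: "mat d ** B = (\<chi> i j. d * B$i$j)" and mr: "B ** mat d = (\<chi> i j. d * B$i$j)"
    for d and B :: "'b^'n^'n"
    by (simp_all add: matrix_matrix_mult_def mat_def vec_eq_iff if_distrib[of "\<lambda>x. _ * x"]
        if_distrib[of "\<lambda>x. x * _"] mult.commute cong: if_cong)
  define Y where "Y = transpose (adjugate (transpose A))"
  have YA: "Y ** A = mat (det A)"
    using arg_cong[OF matrix_mul_adjugate[of "transpose A"], of transpose]
    by (simp add: matrix_transpose_mul Y_def tm)
  have "(Y ** A) ** adjugate A = Y ** mat (det A)"
    by (simp only: matrix_mul_assoc[symmetric] matrix_mul_adjugate)
  then have "Y = adjugate A"
    using assms unfolding YA ml mr by (simp add: vec_eq_iff)
  with YA show ?thesis by simp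
qed

lemma det_polys_over:
  fixes A :: "'a::field poly^'n^'n"
  assumes S: "is_subfield S" and "\<And>i j. A $ i $ j \<in> polys_over S"
  shows "det A \<in> polys_over S"
proof -
  note c = polys_over_closed[OF S]
  have "of_int (sign p) \<in> polys_over S" for p :: "'n \<Rightarrow> 'n"
    by (cases rule: sign_cases[of p]) (auto simp: c)
  then show ?thesis unfolding det_def by (intro c assms)
qed

lemma adjugate_polys_over:
  fixes A :: "'a::field poly^'n^'n"
  assumes S: "is_subfield S" and "\<And>i j. A $ i $ j \<in> polys_over S"
  shows "adjugate A $ j $ i \<in> polys_over S"
  using polys_over_closed(1,2)[OF S] assms(2)
  by (auto simp: adjugate_def row_def axis_def intro!: det_polys_over[OF S])

section \<open>Frobenius and the valuation\<close>

locale function_field =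
  fixes p q :: nat and T :: "'a::field" and nv :: "'a \<Rightarrow> real"
  assumes prime_p: "prime p" and char_p: "of_nat p = (0::'a)"
    and q_eq: "\<exists>e\<ge>1. q = p ^ e"
    and nv_nonneg: "nv x \<ge> 0"
    and nv_zero_iff: "nv x = 0 \<longleftrightarrow> x = 0"
    and nv_mult: "nv (x * y) = nv x * nv y"
    and nv_ultra: "nv (x + y) \<le> max (nv x) (nv y)"
    and nv_T: "nv T = real q"
    and complete: "\<forall>X::nat \<Rightarrow> 'a. (\<forall>e>0. \<exists>N. \<forall>m\<ge>N. \<forall>n\<ge>N. nv (X m - X n) < e)
                      \<longrightarrow> (\<exists>L. (\<lambda>n. nv (X n - L)) \<longlonglongrightarrow> 0)"
    and alg_closed: "\<forall>f::'a poly. degree f \<ge> 1 \<longrightarrow> (\<exists>x. poly f x = 0)"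
begin

abbreviation \<phi> :: "'a \<Rightarrow> 'a" where "\<phi> \<equiv> frob_inv q"

lemma q_gt_1: "q > 1"
proof -
  obtain e where "e \<ge> 1" "q = p ^ e" using q_eq by blast
  then show ?thesis using prime_gt_1_nat[OF prime_p] by (simp add: one_less_power del: One_nat_def)
qed

lemma q_pos [simp]: "q > 0" "q \<noteq> 0"
  using q_gt_1 by simp_all

lemma char_eq: "CHAR('a) = p"
proof -
  have "CHAR('a) dvd p" using char_p by (simp add: of_nat_eq_0_iff_char_dvd)
  then show ?thesis using prime_p by (metis One_nat_def CHAR_not_1 prime_nat_iff)
qed

lemma frob_pow_add: "(x + y :: 'a) ^ (q ^ M) = x ^ (q ^ M) + y ^ (q ^ M)"
proof -
  obtain e where "q = p ^ e" using q_eq by blast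
  then have "q ^ M = CHAR('a) ^ (e * M)" by (simp add: char_eq power_mult)
  then show ?thesis by (rule freshmans_dream'[rotated]) (simp add: char_eq prime_p)
qed

lemma frob_pow_sum: "(sum f A :: 'a) ^ (q ^ M) = (\<Sum>i\<in>A. f i ^ (q ^ M))"
  by (induction A rule: infinite_finite_induct) (auto simp: frob_pow_add power_0_left)

lemma frob_add: "(x + y :: 'a) ^ q = x ^ q + y ^ q"
  using frob_pow_add[of x y 1] by simp

lemma frob_uminus: "(- x :: 'a) ^ q = - (x ^ q)"
  using frob_add[of x "-x"] by (simp add: eq_neg_iff_add_eq_0 add.commute power_0_left)

lemma frob_inj: "x ^ q = y ^ q \<Longrightarrow> x = (y :: 'a)"
  using frob_add[of x "-y"] frob_uminus[of y] by auto

lemma frob_surj: "\<exists>y. y ^ q = (x :: 'a)"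
proof -
  have "degree (monom 1 q - [:x:]) = q"
    using q_gt_1 degree_add_eq_left[of "- [:x:]" "monom 1 q"]
    by (simp add: degree_monom_eq del: minus_pCons)
  then obtain y where "poly (monom 1 q - [:x:]) y = 0"
    using alg_closed[rule_format, of "monom 1 q - [:x:]"] q_gt_1 by auto
  then show ?thesis by (auto simp: poly_monom)
qed

lemma frob_inv_pow [simp]: "\<phi> x ^ q = x"
  unfolding frob_inv_def by (rule theI') (metis frob_inj frob_surj)

lemma frob_inv_eqI: "y ^ q = x \<Longrightarrow> \<phi> x = y"
  by (rule frob_inj) simp

lemma frob_inv_add: "\<phi> (x + y) = \<phi> x + \<phi> y"
  by (rule frob_inv_eqI) (simp add: frob_add)

lemma frob_inv_mult: "\<phi> (x * y) = \<phi> x * \<phi> y"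
  by (rule frob_inv_eqI) (simp add: power_mult_distrib)

lemma frob_inv_0 [simp]: "\<phi> 0 = 0"
  by (rule frob_inv_eqI) (simp add: power_0_left)

lemma frob_inv_eq_0_iff [simp]: "\<phi> x = 0 \<longleftrightarrow> x = 0"
  by (metis frob_inv_0 frob_inv_pow)

lemma frob_inv_sum: "\<phi> (sum f A) = (\<Sum>i\<in>A. \<phi> (f i))"
  by (induction A rule: infinite_finite_induct) (auto simp: frob_inv_add)

lemma frob_inv_uminus: "\<phi> (- x) = - \<phi> x"
  by (rule frob_inv_eqI) (simp add: frob_uminus)

lemma frob_inv_diff: "\<phi> (x - y) = \<phi> x - \<phi> y"
  using frob_inv_add[of x "-y"] by (simp add: frob_inv_uminus)

lemma frob_inv_power: "\<phi> (x ^ n) = \<phi> x ^ n"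
  by (rule frob_inv_eqI) (metis frob_inv_pow power_mult mult.commute)

section \<open>Consequences of the ultrametric axioms\<close>

lemma nv_0 [simp]: "nv 0 = 0"
  using nv_zero_iff by blast

lemma nv_pos: "x \<noteq> 0 \<Longrightarrow> nv x > 0"
  using nv_nonneg[of x] nv_zero_iff[of x] by linarith

lemma nv_1 [simp]: "nv 1 = 1"
  using nv_mult[of 1 1] nv_pos[of 1] by simp

lemma nv_power: "nv (x ^ n) = nv x ^ n"
  by (induction n) (auto simp: nv_mult)

lemma nv_uminus [simp]: "nv (- x) = nv x"
proof -
  have "nv (- 1) ^ 2 = 1" using nv_power[of "-1" 2] by simp
  then have "nv (- 1) = 1" using nv_nonneg[of "-1"] by (auto simp: power2_eq_1_iff)
  then show ?thesis using nv_mult[of "-1" x] by simp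
qed

lemma nv_diff: "nv (x - y) \<le> max (nv x) (nv y)"
  using nv_ultra[of x "- y"] by simp

lemma nv_sum_le:
  assumes "\<And>i. i \<in> A \<Longrightarrow> nv (f i) \<le> C" "C \<ge> 0"
  shows "nv (sum f A) \<le> C"
  using assms by (induction A rule: infinite_finite_induct) (auto intro: order_trans[OF nv_ultra])

lemma nv_add_eq: "nv x < nv y \<Longrightarrow> nv (x + y) = nv y"
  using nv_ultra[of x y] nv_diff[of "x + y" x] by auto

lemma nv_frob_inv: "nv (\<phi> x) ^ q = nv x"
  by (metis frob_inv_pow nv_power)

lemma nv_frob_inv_root: "nv (\<phi> x) = root q (nv x)"
  using nv_frob_inv[of x] nv_nonneg by (metis q_pos(1) real_root_pos2)

lemma T_nonzero: "T \<noteq> 0"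
  using nv_T q_gt_1 by auto

lemma Fq_subfield: "is_subfield (Fq q :: 'a set)"
  using q_gt_1 unfolding is_subfield_def Fq_def
  by (auto simp: frob_add frob_uminus power_mult_distrib power_inverse power_0_left)

lemma nv_Fq: "x \<in> Fq q \<Longrightarrow> x \<noteq> 0 \<Longrightarrow> nv x = 1"
proof -
  assume x: "x \<in> Fq q" "x \<noteq> 0"
  then have "nv x ^ q = nv x" by (metis (mono_tags, lifting) Fq_def mem_Collect_eq nv_power)
  moreover have "nv x ^ q = nv x * nv x ^ (q - 1)"
    using power_Suc[of "nv x" "q - 1"] by simp
  ultimately have "nv x ^ (q - 1) = 1" using nv_pos[OF x(2)] by simp
  then show ?thesis
    using power_eq_imp_eq_base[of "nv x" "q - 1" 1] nv_nonneg[of x] q_gt_1 by simp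
qed

text \<open>Nonzero constants have absolute value 1 and \<open>T\<close> has a larger one, so the
  leading term dominates. In particular \<open>T\<close> is transcendental over
  \<open>Fq q\<close>.\<close>

lemma nv_poly_T:
  assumes "f \<in> polys_over (Fq q)" "f \<noteq> 0"
  shows "nv (poly f T) = real q ^ degree f"
  using assms
proof (induction f)
  case (pCons a f)
  have a: "a \<in> Fq q" and f: "f \<in> polys_over (Fq q)"
    using pCons.prems by (auto simp: polys_over_def coeff_pCons split: nat.splits)
  have le: "nv a \<le> 1" using nv_Fq[OF a] by (cases "a = 0") auto
  show ?case
  proof (cases "f = 0")
    case True
    then show ?thesis using pCons.hyps nv_Fq[OF a] by auto
  next
    case False
    have "nv (T * poly f T) = real q ^ Suc (degree f)"
      using pCons.IH[OF f False] by (simp add: nv_mult nv_T)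
    moreover have "real q ^ Suc (degree f) > 1" using q_gt_1 by (simp add: one_less_power del: power_Suc)
    ultimately show ?thesis using le False nv_add_eq[of a "T * poly f T"] by simp
  qed
qed simp

text \<open>The polynomials in \<open>T\<close> of bounded degree play the role of bounded integers;
  as \<open>T\<close> is transcendental, they form a space of dimension \<open>h + 1\<close> over
  the constants.\<close>

definition AA :: "nat \<Rightarrow> 'a set" where
  "AA h = {poly f T | f. f \<in> polys_over (Fq q) \<and> degree f \<le> h}"

lemma AAI: "f \<in> polys_over (Fq q) \<Longrightarrow> degree f \<le> h \<Longrightarrow> poly f T \<in> AA h"
  unfolding AA_def by blast

lemma AAE:
  assumes "x \<in> AA h"
  obtains f where "x = poly f T" "f \<in> polys_over (Fq q)" "degree f \<le> h"
  using assms unfolding AA_def by blast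

lemma AA_mono: "x \<in> AA h \<Longrightarrow> h \<le> h' \<Longrightarrow> x \<in> AA h'"
  unfolding AA_def by (blast intro: order_trans)

lemma AA_0 [simp]: "0 \<in> AA h"
  using AAI[of 0 h] polys_over_closed(1)[OF Fq_subfield] by simp

lemma AA_1 [simp]: "1 \<in> AA h"
  using AAI[of 1 h] polys_over_closed(2)[OF Fq_subfield] by simp

lemma AA_T [simp]: "T \<in> AA 1"
  using AAI[of "monom 1 1" 1] polys_over_closed(11)[OF Fq_subfield] is_subfieldD(2)[OF Fq_subfield]
  by (simp add: degree_monom_eq poly_monom)

lemma AA_add: "x \<in> AA h \<Longrightarrow> y \<in> AA h \<Longrightarrow> x + y \<in> AA h"
  by (elim AAE, hypsubst, subst poly_add[symmetric], rule AAI)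
    (auto intro: polys_over_closed[OF Fq_subfield] degree_add_le)

lemma AA_uminus: "x \<in> AA h \<Longrightarrow> - x \<in> AA h"
  by (elim AAE, hypsubst, subst poly_minus[symmetric], rule AAI)
    (auto intro: polys_over_closed[OF Fq_subfield])

lemma AA_mult: "x \<in> AA h \<Longrightarrow> y \<in> AA h' \<Longrightarrow> x * y \<in> AA (h + h')"
  by (elim AAE, hypsubst, subst poly_mult[symmetric], rule AAI)
    (auto intro: polys_over_closed[OF Fq_subfield] order_trans[OF degree_mult_le] add_mono)

lemma AA_sum: "(\<And>i. i \<in> B \<Longrightarrow> f i \<in> AA h) \<Longrightarrow> sum f B \<in> AA h"
  by (induction B rule: infinite_finite_induct) (auto intro: AA_add)

lemma nv_AA_le: "x \<in> AA h \<Longrightarrow> nv x \<le> real q ^ h"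
proof (elim AAE)
  fix f assume f: "x = poly f T" "f \<in> polys_over (Fq q)" "degree f \<le> h"
  show "nv x \<le> real q ^ h"
    using f q_gt_1 nv_poly_T[of f] by (cases "f = 0") (auto intro: power_increasing)
qed

text \<open>Discreteness of the polynomial ring, the analogue of a nonzero integer having absolute
  value at least 1; every Liouville estimate below rests on it.\<close>

lemma nv_AA_ge: "x \<in> AA h \<Longrightarrow> x \<noteq> 0 \<Longrightarrow> nv x \<ge> 1"
proof (elim AAE)
  fix f assume f: "x = poly f T" "f \<in> polys_over (Fq q)" "x \<noteq> 0"
  then show "nv x \<ge> 1" using q_gt_1 nv_poly_T[of f] by (cases "f = 0") auto
qed

section \<open>The rational function field and Siegel's lemma over it\<close>

abbreviation kk :: "'a set" where "kk \<equiv> kfield q T"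

lemma kfieldI: "x \<in> AA h \<Longrightarrow> y \<in> AA h' \<Longrightarrow> y \<noteq> 0 \<Longrightarrow> x / y \<in> kk"
  unfolding kfield_def polys_over_def AA_def by blast

lemma kfieldE:
  assumes "x \<in> kk"
  obtains a b h where "a \<in> AA h" "b \<in> AA h" "b \<noteq> 0" "x = a / b"
proof -
  obtain f g where fg: "x = poly f T / poly g T" "f \<in> polys_over (Fq q)" "g \<in> polys_over (Fq q)"
      "poly g T \<noteq> 0"
    using assms unfolding kfield_def polys_over_def by blast
  show ?thesis
    by (rule that[of "poly f T" "max (degree f) (degree g)" "poly g T"]) (auto intro!: AAI fg)
qed

lemma AA_kfield: "x \<in> AA h \<Longrightarrow> x \<in> kk"
  using kfieldI[of x h 1 0] by simp

lemma kfield_subfield: "is_subfield kk"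
  unfolding is_subfield_def
proof (intro conjI ballI)
  show "0 \<in> kk" "1 \<in> kk" by (auto intro: AA_kfield[of _ 0])
next
  fix x y assume "x \<in> kk" "y \<in> kk"
  then obtain a b h a' b' h' where *: "a \<in> AA h" "b \<in> AA h" "b \<noteq> 0" "x = a / b"
    "a' \<in> AA h'" "b' \<in> AA h'" "b' \<noteq> 0" "y = a' / b'" by (metis kfieldE)
  have "x + y = (a * b' + b * a') / (b * b')" "x * y = (a * a') / (b * b')"
    using * by (auto simp: field_simps)
  then show "x + y \<in> kk" "x * y \<in> kk"
    using * by (auto intro!: kfieldI AA_add AA_mult)
next
  fix x assume "x \<in> kk"
  then obtain a b h where *: "a \<in> AA h" "b \<in> AA h" "b \<noteq> 0" "x = a / b" by (metis kfieldE)
  then show "- x \<in> kk" using kfieldI[of "- a" h b h] by (simp add: AA_uminus)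
  show "inverse x \<in> kk"
    using * kfieldI[of b h a h] AA_kfield[of 0 0] by (cases "a = 0") auto
qed

lemma common_denominator:
  assumes "finite S" "S \<subseteq> kk"
  shows "\<exists>a h. a \<in> AA h \<and> a \<noteq> 0 \<and> (\<forall>x\<in>S. a * x \<in> AA h)"
  using assms
proof (induction S rule: finite_induct)
  case empty
  show ?case by (rule exI[of _ 1], rule exI[of _ 0]) simp
next
  case (insert x S)
  then obtain a h where a: "a \<in> AA h" "a \<noteq> 0" "\<forall>x\<in>S. a * x \<in> AA h" by auto
  from insert obtain c b h' where x: "c \<in> AA h'" "b \<in> AA h'" "b \<noteq> 0" "x = c / b"
    by (metis kfieldE insert_subset)
  show ?case
  proof (rule exI[of _ "b * a"], rule exI[of _ "h' + h"], intro conjI ballI)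
    fix y assume "y \<in> insert x S"
    then consider "y = x" | "y \<in> S" by blast
    then show "b * a * y \<in> AA (h' + h)"
    proof cases
      case 1
      have "b * a * y = c * a" using x 1 by simp
      then show ?thesis using AA_mult[OF x(1) a(1)] by metis
    next
      case 2
      then show ?thesis using a x AA_mult[of b h' "a * y" h] by (simp add: mult.assoc)
    qed
  qed (use a x AA_mult in auto)
qed

text \<open>Comparing coefficients of powers of \<open>T\<close> turns the system into one over the
  constants: each unknown has \<open>D + 1\<close> coefficients and each equation contributes
  \<open>D + h + 1\<close>, so counting dimensions replaces the pigeonhole principle.\<close>

lemma siegel_AA:
  assumes "finite I" "finite J"
    and "\<And>i j. i \<in> I \<Longrightarrow> j \<in> J \<Longrightarrow> a i j \<in> AA h"
    and less: "card I * (D + h + 1) < card J * (D + 1)"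
  shows "\<exists>y. (\<forall>j\<in>J. y j \<in> AA D) \<and> (\<exists>j\<in>J. y j \<noteq> 0) \<and> (\<forall>i\<in>I. (\<Sum>j\<in>J. a i j * y j) = 0)"
proof -
  note F = Fq_subfield
  note c = polys_over_closed[OF F]
  have "\<exists>f. a i j = poly f T \<and> f \<in> polys_over (Fq q) \<and> degree f \<le> h" if "i \<in> I" "j \<in> J" for i j
    using assms(3)[OF that] unfolding AA_def by blast
  then obtain f where f: "\<And>i j. i \<in> I \<Longrightarrow> j \<in> J \<Longrightarrow>
      a i j = poly (f i j) T \<and> f i j \<in> polys_over (Fq q) \<and> degree (f i j) \<le> h" by metis
  define b where "b = (\<lambda>(i, l) (j, k). coeff (f i j * monom 1 k) l)"
  have "\<exists>y. (\<forall>j\<in>J \<times> {..D}. y j \<in> Fq q) \<and> (\<exists>j\<in>J \<times> {..D}. y j \<noteq> 0) \<and>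
      (\<forall>i\<in>I \<times> {..D + h}. (\<Sum>j\<in>J \<times> {..D}. b i j * y j) = 0)"
  proof (rule ex_nontrivial_solution[OF F])
    show "card (I \<times> {..D + h}) < card (J \<times> {..D})" using less by (simp add: card_cartesian_product)
    show "b i j \<in> Fq q" if "i \<in> I \<times> {..D + h}" "j \<in> J \<times> {..D}" for i j
    proof -
      have "f (fst i) (fst j) * monom 1 (snd j) \<in> polys_over (Fq q)"
        using that f by (intro c is_subfieldD(2)[OF F]) auto
      then show ?thesis by (auto simp: b_def polys_over_def split: prod.splits)
    qed
  qed (use assms in auto)
  then obtain y where y: "\<forall>j\<in>J \<times> {..D}. y j \<in> Fq q" "\<exists>j\<in>J \<times> {..D}. y j \<noteq> 0"
      "\<forall>i\<in>I \<times> {..D + h}. (\<Sum>j\<in>J \<times> {..D}. b i j * y j) = 0" by blast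
  define g where "g j = (\<Sum>k\<le>D. monom (y (j, k)) k)" for j
  have cg: "coeff (g j) k = (if k \<le> D then y (j, k) else 0)" for j k
    by (simp add: g_def coeff_sum)
  have gF: "g j \<in> polys_over (Fq q)" if "j \<in> J" for j
    using y(1) that unfolding g_def by (intro c) auto
  have dg: "degree (g j) \<le> D" for j
    unfolding g_def by (intro degree_sum_le) (auto intro: order_trans[OF degree_monom_le])
  have zero: "(\<Sum>j\<in>J. f i j * g j) = 0" if i: "i \<in> I" for i
  proof (rule poly_eqI)
    fix l
    have "degree (f i j * g j) \<le> D + h" if "j \<in> J" for j
      using degree_mult_le[of "f i j" "g j"] f[OF i that] dg[of j] by simp
    then have "degree (\<Sum>j\<in>J. f i j * g j) \<le> D + h"
      by (intro degree_sum_le assms)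
    moreover have "coeff (\<Sum>j\<in>J. f i j * g j) l = 0" if "l \<le> D + h"
    proof -
      have "f i j * g j = (\<Sum>k\<le>D. smult (y (j, k)) (f i j * monom 1 k))" for j
        unfolding g_def sum_distrib_left
        by (intro sum.cong refl) (metis mult.right_neutral mult_smult_right smult_monom)
      then have "coeff (\<Sum>j\<in>J. f i j * g j) l
          = (\<Sum>j\<in>J. \<Sum>k\<le>D. coeff (f i j * monom 1 k) l * y (j, k))"
        by (simp add: coeff_sum mult.commute)
      also have "\<dots> = (\<Sum>jk\<in>J \<times> {..D}. b (i, l) jk * y jk)"
        by (simp add: sum.cartesian_product b_def case_prod_unfold)
      finally show ?thesis using y(3) i that by simp
    qed
    ultimately show "coeff (\<Sum>j\<in>J. f i j * g j) l = coeff 0 l"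
      by (metis coeff_0 coeff_eq_0 linorder_not_le order_le_less_trans)
  qed
  show ?thesis
  proof (intro exI[of _ "\<lambda>j. poly (g j) T"] conjI ballI)
    show "poly (g j) T \<in> AA D" if "j \<in> J" for j using gF[OF that] dg by (rule AAI)
    obtain j k where jk: "j \<in> J" "k \<le> D" "y (j, k) \<noteq> 0" using y(2) by auto
    then have "g j \<noteq> 0" using cg[of j k] by auto
    then have "poly (g j) T \<noteq> 0" using nv_poly_T[OF gF[OF jk(1)]] by auto
    then show "\<exists>j\<in>J. poly (g j) T \<noteq> 0" using jk by blast
    show "(\<Sum>j\<in>J. a i j * poly (g j) T) = 0" if "i \<in> I" for i
      using arg_cong[OF zero[OF that], of "\<lambda>r. poly r T"] f that by (simp add: poly_sum)
  qed
qed

section \<open>Finite extensions of the rational function field\<close>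

definition kspan :: "'a set \<Rightarrow> 'a set" where
  "kspan W = {\<Sum>w\<in>W. c w * w | c. \<forall>w\<in>W. c w \<in> kk}"

text \<open>The multipliers of the span of \<open>W\<close>. Spans stable under multiplication by
  the elements of interest stand in for finite extension fields.\<close>

definition stab :: "'a set \<Rightarrow> 'a set" where
  "stab W = {y. \<forall>w\<in>W. y * w \<in> kspan W}"

definition indep :: "'a set \<Rightarrow> bool" where
  "indep W \<longleftrightarrow> (\<forall>c. (\<forall>w\<in>W. c w \<in> kk) \<longrightarrow> (\<Sum>w\<in>W. c w * w) = 0 \<longrightarrow> (\<forall>w\<in>W. c w = 0))"

text \<open>\<open>acts W h x\<close> says that multiplication by \<open>x\<close> maps the lattice spanned by \<open>W\<close> to itself with
  matrix entries of degree at most \<open>h\<close>. It replaces the maximum of the conjugates as a measure of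
  size; both the Siegel and the Liouville estimate reduce to linear algebra on the lattice.\<close>

definition acts :: "'a set \<Rightarrow> nat \<Rightarrow> 'a \<Rightarrow> bool" where
  "acts W h x \<longleftrightarrow> (\<forall>w\<in>W. \<exists>c. (\<forall>w'\<in>W. c w' \<in> AA h) \<and> x * w = (\<Sum>w'\<in>W. c w' * w'))"

lemmas kk_closed = is_subfieldD[OF kfield_subfield] subfield_closed[OF kfield_subfield]

lemma kspanI: "(\<And>w. w \<in> W \<Longrightarrow> c w \<in> kk) \<Longrightarrow> (\<Sum>w\<in>W. c w * w) \<in> kspan W"
  unfolding kspan_def by blast

lemma kspanE:
  assumes "z \<in> kspan W"
  obtains c where "z = (\<Sum>w\<in>W. c w * w)" "\<And>w. w \<in> W \<Longrightarrow> c w \<in> kk"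
  using assms unfolding kspan_def by blast

lemma kspan_0 [simp]: "0 \<in> kspan W"
  using kspanI[of W "\<lambda>_. 0"] kk_closed(1) by simp

lemma kspan_add: "x \<in> kspan W \<Longrightarrow> y \<in> kspan W \<Longrightarrow> x + y \<in> kspan W"
  by (elim kspanE, hypsubst, subst sum.distrib[symmetric], subst distrib_right[symmetric],
      rule kspanI) (auto intro: kk_closed)

lemma kspan_scale: "a \<in> kk \<Longrightarrow> x \<in> kspan W \<Longrightarrow> a * x \<in> kspan W"
  by (elim kspanE, hypsubst, subst sum_distrib_left, subst mult.assoc[symmetric],
      rule kspanI) (auto intro: kk_closed)

lemma kspan_sum: "(\<And>i. i \<in> A \<Longrightarrow> f i \<in> kspan W) \<Longrightarrow> sum f A \<in> kspan W"
  by (induction A rule: infinite_finite_induct) (auto intro: kspan_add)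

lemma kspan_base: "finite W \<Longrightarrow> w \<in> W \<Longrightarrow> w \<in> kspan W"
  using kspanI[of W "\<lambda>v. if v = w then 1 else 0"] kk_closed(1,2)
  by (simp add: if_distrib[of "\<lambda>x. x * _"] cong: if_cong)

lemma kspan_mult:
  assumes "z \<in> kspan W" "\<And>w. w \<in> W \<Longrightarrow> y * w \<in> kspan W'"
  shows "y * z \<in> kspan W'"
proof -
  obtain c where c: "z = (\<Sum>w\<in>W. c w * w)" "\<And>w. w \<in> W \<Longrightarrow> c w \<in> kk"
    using assms(1) unfolding kspan_def by blast
  have "y * z = (\<Sum>w\<in>W. c w * (y * w))"
    unfolding c(1) sum_distrib_left by (simp add: mult.left_commute)
  then show ?thesis using c(2) assms(2) by (auto intro: kspan_sum kspan_scale)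
qed

lemma stab_mult_kspan: "y \<in> stab W \<Longrightarrow> z \<in> kspan W \<Longrightarrow> y * z \<in> kspan W"
  by (rule kspan_mult) (auto simp: stab_def)

lemma stab_closed:
  assumes "finite W"
  shows "y \<in> stab W \<Longrightarrow> z \<in> stab W \<Longrightarrow> y + z \<in> stab W"
    "y \<in> stab W \<Longrightarrow> z \<in> stab W \<Longrightarrow> y * z \<in> stab W"
    "a \<in> kk \<Longrightarrow> a \<in> stab W"
    "y \<in> stab W \<Longrightarrow> y ^ n \<in> stab W"
proof -
  show 1: "y + z \<in> stab W" if "y \<in> stab W" "z \<in> stab W"
    using that by (auto simp: stab_def distrib_right intro: kspan_add)
  show 2: "y * z \<in> stab W" if "y \<in> stab W" "z \<in> stab W" for y z
    using that stab_mult_kspan[of y] unfolding stab_def by (auto simp: mult.assoc)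
  show 3: "a \<in> stab W" if "a \<in> kk" for a
    using that assms by (auto simp: stab_def intro: kspan_scale kspan_base)
  show "y ^ n \<in> stab W" if "y \<in> stab W"
    by (induction n) (auto intro: 2 3 that kk_closed)
qed

text \<open>The \<open>card W + 1\<close> elements \<open>y ^ i * w0\<close> lie in a span with
  \<open>card W\<close> generators, so they are dependent; cancelling \<open>w0\<close> leaves a
  polynomial equation for \<open>y\<close>.\<close>

lemma stab_algebraic:
  assumes W: "finite W" "w0 \<in> W" "w0 \<noteq> 0" and y: "y \<in> stab W"
  shows "y \<in> kbar q T"
proof -
  have "\<exists>c. (\<forall>w\<in>W. c w \<in> kk) \<and> y ^ i * w0 = (\<Sum>w\<in>W. c w * w)" for i
  proof -
    have "y ^ i * w0 \<in> kspan W" using stab_closed(4)[OF W(1) y] W(2) by (simp add: stab_def)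
    then show ?thesis unfolding kspan_def by auto
  qed
  then obtain c where c: "\<And>i w. w \<in> W \<Longrightarrow> c i w \<in> kk" "\<And>i. y ^ i * w0 = (\<Sum>w\<in>W. c i w * w)"
    by metis
  obtain x where x: "\<forall>i\<in>{..card W}. x i \<in> kk" "\<exists>i\<in>{..card W}. x i \<noteq> 0"
      "\<forall>w\<in>W. (\<Sum>i\<le>card W. c i w * x i) = 0"
    using ex_nontrivial_solution[OF kfield_subfield W(1), of "{..card W}" "\<lambda>w i. c i w"] c(1)
    by auto
  define P where "P = (\<Sum>i\<le>card W. monom (x i) i)"
  have cP: "coeff P k = (if k \<le> card W then x k else 0)" for k
    by (simp add: P_def coeff_sum)
  have "poly P y * w0 = (\<Sum>i\<le>card W. x i * (y ^ i * w0))"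
    by (simp add: P_def poly_sum poly_monom sum_distrib_right mult.assoc)
  also have "\<dots> = (\<Sum>w\<in>W. (\<Sum>i\<le>card W. c i w * x i) * w)"
    unfolding c(2) sum_distrib_left sum_distrib_right
    by (subst sum.swap) (simp add: mult_ac)
  also have "\<dots> = 0" using x(3) by simp
  finally have "poly P y = 0" using W(3) by simp
  moreover have "P \<noteq> 0" using x(2) cP by (metis atMost_iff coeff_0)
  moreover have "\<forall>i. coeff P i \<in> kk" using x(1) cP kk_closed(1) by simp
  ultimately show ?thesis unfolding kbar_def algebraic_over_def by blast
qed

text \<open>Each algebraic element is adjoined through its powers below the degree of an
  annihilating polynomial. \<open>W\<close> inside \<open>stab W\<close> makes the span a ring, and
  \<open>1\<close> in the span keeps it from being zero.\<close>

lemma ex_stab: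
  assumes "finite X" "X \<subseteq> kbar q T"
  shows "\<exists>W. finite W \<and> X \<union> W \<subseteq> stab W \<and> 1 \<in> kspan W"
  using assms
proof (induction X rule: finite_induct)
  case empty
  have "1 \<in> kspan {1}" by (rule kspan_base) auto
  then show ?case by (intro exI[of _ "{1}"]) (auto simp: stab_def)
next
  case (insert x X)
  then obtain W where W: "finite W" "X \<union> W \<subseteq> stab W" "1 \<in> kspan W" by auto
  from insert obtain f where f: "f \<noteq> 0" "\<forall>i. coeff f i \<in> kk" "poly f x = 0"
    unfolding kbar_def algebraic_over_def by auto
  define n where "n = degree f"
  define c where "c = coeff f n"
  have c: "c \<noteq> 0" using f by (simp add: c_def n_def)
  have n: "n > 0"
  proof (rule ccontr)
    assume "\<not> ?thesis"
    then obtain b where "f = [:b:]" unfolding n_def by (metis degree_eq_zeroE neq0_conv)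
    with f show False by simp
  qed
  have xn: "x ^ n = (\<Sum>i<n. - coeff f i / c * x ^ i)"
  proof -
    have "0 = (\<Sum>i<n. coeff f i * x ^ i) + c * x ^ n"
      using f(3) by (simp add: poly_altdef n_def c_def flip: lessThan_Suc_atMost)
    then have "c * x ^ n = - (\<Sum>i<n. coeff f i * x ^ i)"
      by (simp add: eq_neg_iff_add_eq_0 add.commute)
    then have "x ^ n = - (\<Sum>i<n. coeff f i * x ^ i) / c"
      using c by (simp add: field_simps)
    then show ?thesis by (simp add: sum_divide_distrib sum_negf)
  qed
  define W' where "W' = (\<lambda>(w, i). w * x ^ i) ` (W \<times> {..<n})"
  have fin: "finite W'" using W by (simp add: W'_def)
  have H1: "x ^ i * z \<in> kspan W'" if "z \<in> kspan W" "i < n" for z i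
    using that(1) by (rule kspan_mult)
      (use that in \<open>auto simp: W'_def mult.commute intro!: kspan_base[OF fin, unfolded W'_def]\<close>)
  have H2: "y \<in> stab W'" if "y \<in> stab W" for y
    unfolding stab_def
  proof (safe)
    fix v assume "v \<in> W'"
    then obtain w i where v: "v = w * x ^ i" "w \<in> W" "i < n" by (auto simp: W'_def)
    have "x ^ i * (y * w) \<in> kspan W'" using that v by (intro H1) (auto simp: stab_def)
    then show "y * v \<in> kspan W'" by (simp add: v mult_ac)
  qed
  have H3: "x \<in> stab W'"
    unfolding stab_def
  proof (safe)
    fix v assume "v \<in> W'"
    then obtain w i where v: "v = w * x ^ i" "w \<in> W" "i < n" by (auto simp: W'_def)
    have "x ^ Suc i * w \<in> kspan W'"
    proof (cases "Suc i < n")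
      case True
      then show ?thesis using v W kspan_base by (intro H1) auto
    next
      case False
      then have "Suc i = n" using v by simp
      then have "x ^ Suc i * w = (\<Sum>j<n. - coeff f j / c * (x ^ j * w))"
        by (simp only: xn sum_distrib_right mult.assoc)
      also have "\<dots> \<in> kspan W'"
        using f(2) v W unfolding c_def
        by (intro kspan_sum kspan_scale H1 kspan_base kk_closed) auto
      finally show ?thesis .
    qed
    then show "x * v \<in> kspan W'" by (simp add: v mult_ac)
  qed
  have "W' \<subseteq> stab W'"
  proof
    fix v assume "v \<in> W'"
    then obtain w i where v: "v = w * x ^ i" "w \<in> W" by (auto simp: W'_def)
    then show "v \<in> stab W'" using W(2) by (auto intro: stab_closed[OF fin] H2 H3)
  qed
  moreover have "1 \<in> kspan W'" using H1[OF W(3) n] by simp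
  ultimately show ?case using fin H2 H3 W(2) by (intro exI[of _ W']) auto
qed

text \<open>In a spanning set of least cardinality no generator is redundant: dropping a dependent
  one would leave the span, and hence all three properties, unchanged.\<close>

lemma ex_stab_indep:
  assumes "finite X" "X \<subseteq> kbar q T"
  shows "\<exists>W. finite W \<and> X \<union> W \<subseteq> stab W \<and> W \<noteq> {} \<and> indep W"
proof -
  obtain W where W: "finite W \<and> X \<union> W \<subseteq> stab W \<and> 1 \<in> kspan W"
    and min: "\<And>V. finite V \<and> X \<union> V \<subseteq> stab V \<and> 1 \<in> kspan V \<Longrightarrow> card W \<le> card V"
    using ex_stab[OF assms]
      ex_has_least_nat[of "\<lambda>W. finite W \<and> X \<union> W \<subseteq> stab W \<and> 1 \<in> kspan W" _ card] by metis
  have "indep W"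
    unfolding indep_def
  proof (intro allI impI ballI, rule ccontr)
    fix c w assume c: "\<forall>w\<in>W. c w \<in> kk" "(\<Sum>w\<in>W. c w * w) = 0" "w \<in> W" "c w \<noteq> 0"
    let ?V = "W - {w}"
    have "w = (\<Sum>v\<in>?V. - c v / c w * v)"
    proof -
      have "c w * w = - (\<Sum>v\<in>?V. c v * v)"
        using sum.remove[of W w "\<lambda>v. c v * v"] W c by (simp add: eq_neg_iff_add_eq_0)
      then have "w = - (\<Sum>v\<in>?V. c v * v) / c w" using c(4) by (simp add: field_simps)
      then show ?thesis by (simp add: sum_divide_distrib sum_negf)
    qed
    also have "\<dots> \<in> kspan ?V" using c by (intro kspanI kk_closed) auto
    finally have w: "w \<in> kspan ?V" .
    have sub: "z \<in> kspan ?V" if "z \<in> kspan W" for z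
    proof -
      have "1 * v \<in> kspan ?V" if "v \<in> W" for v
        using that w kspan_base[of ?V v] W by (cases "v = w") auto
      from kspan_mult[OF \<open>z \<in> kspan W\<close> this] show ?thesis by simp
    qed
    have "finite ?V \<and> X \<union> ?V \<subseteq> stab ?V \<and> 1 \<in> kspan ?V"
      using W sub by (auto simp: stab_def)
    from min[OF this] show False
      using W card_Diff1_less[of W w] c(3) by linarith
  qed
  moreover have "W \<noteq> {}" using W by (auto simp: kspan_def)
  ultimately show ?thesis using W by blast
qed

text \<open>Two algebraic elements have a common stable span, on which their sum and product act
  too; for inverses the annihilating polynomial is reversed.\<close>

lemma kbar_subfield: "is_subfield (kbar q T :: 'a set)"
proof -
  have two: "\<exists>W w. finite W \<and> w \<in> W \<and> w \<noteq> 0 \<and> x \<in> stab W \<and> y \<in> stab W"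
    if "x \<in> kbar q T" "y \<in> kbar q T" for x y :: 'a
  proof -
    have "finite {x, y}" "{x, y} \<subseteq> kbar q T" using that by auto
    from ex_stab[OF this] obtain W where W: "finite W" "{x, y} \<union> W \<subseteq> stab W" "1 \<in> kspan W"
      by blast
    have "\<exists>w\<in>W. w \<noteq> 0"
    proof (rule ccontr)
      assume *: "\<not> ?thesis"
      obtain c where "1 = (\<Sum>w\<in>W. c w * w)" using W(3) unfolding kspan_def by blast
      also have "\<dots> = 0" using * by (intro sum.neutral) auto
      finally show False by simp
    qed
    with W show ?thesis by blast
  qed
  have k: "a \<in> kbar q T" if "a \<in> kk" for a
    using stab_algebraic[of "{1}" 1 a] stab_closed(3)[of "{1}" a] that by simp
  have "inverse x \<in> kbar q T" if x: "x \<in> kbar q T" "x \<noteq> 0" for x :: 'a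
  proof -
    from x(1) obtain f where f: "f \<noteq> 0" "\<forall>i. coeff f i \<in> kk" "poly f x = 0"
      unfolding kbar_def algebraic_over_def by auto
    have "poly (reflect_poly f) (inverse x) = 0"
      using poly_reflect_poly_nz[of "inverse x" f] x f(3) by simp
    moreover have "\<forall>i. coeff (reflect_poly f) i \<in> kk"
      using f(2) kk_closed(1) by (auto simp: coeff_reflect_poly)
    moreover have "reflect_poly f \<noteq> 0" using f(1) by simp
    ultimately show ?thesis unfolding kbar_def algebraic_over_def by blast
  qed
  moreover have "x + y \<in> kbar q T \<and> x * y \<in> kbar q T \<and> - x \<in> kbar q T"
    if xy: "x \<in> kbar q T" "y \<in> kbar q T" for x y :: 'a
  proof -
    obtain W w where W: "finite W" "w \<in> W" "w \<noteq> 0" "x \<in> stab W" "y \<in> stab W"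
      using two[OF xy] by blast
    note a = stab_algebraic[OF W(1-3)] and s = stab_closed[OF W(1)]
    have "- x = (- 1) * x" by simp
    moreover have "(- 1) * x \<in> kbar q T"
      by (intro a s(2) s(3) W kk_closed)
    ultimately have "- x \<in> kbar q T" by simp
    then show ?thesis using a s W by auto
  qed
  moreover have "0 \<in> kbar q T" "1 \<in> kbar q T" by (auto intro: k kk_closed)
  moreover have "inverse x \<in> kbar q T" if "x \<in> kbar q T" for x :: 'a
    using calculation that by (cases "x = 0") auto
  ultimately show ?thesis unfolding is_subfield_def by blast
qed

text \<open>Multiplication has matrix entries in \<open>kk\<close>, and \<open>a\<close> clears
  their denominators. The basis is rescaled as well: the elements of \<open>a * W\<close> act with
  polynomial entries on the lattice that they span themselves.\<close>

lemma ex_lattice: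
  assumes "finite X" "X \<subseteq> kbar q T"
  shows "\<exists>W a h. finite W \<and> W \<noteq> {} \<and> indep W \<and> a \<in> AA h \<and> a \<noteq> 0 \<and>
    (\<forall>y\<in>X. acts W h (a * y)) \<and> (\<forall>w\<in>W. acts W h w)"
proof -
  obtain W where W: "finite W" "X \<union> W \<subseteq> stab W" "W \<noteq> {}" "indep W"
    using ex_stab_indep[OF assms] by blast
  have "\<exists>c. (\<forall>w'\<in>W. c w' \<in> kk) \<and> y * w = (\<Sum>w'\<in>W. c w' * w')" if "y \<in> X \<union> W" "w \<in> W" for y w
  proof -
    have "y * w \<in> kspan W" using W(2) that unfolding stab_def by blast
    then show ?thesis unfolding kspan_def by blast
  qed
  then obtain C where C: "\<And>y w w'. y \<in> X \<union> W \<Longrightarrow> w \<in> W \<Longrightarrow> w' \<in> W \<Longrightarrow> C y w w' \<in> kk"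
    "\<And>y w. y \<in> X \<union> W \<Longrightarrow> w \<in> W \<Longrightarrow> y * w = (\<Sum>w'\<in>W. C y w w' * w')" by metis
  define S where "S = (\<lambda>(y, w, w'). C y w w') ` ((X \<union> W) \<times> W \<times> W)"
  have S: "finite S" "S \<subseteq> kk" using C(1) W assms by (auto simp: S_def)
  obtain a h where a: "a \<in> AA h" "a \<noteq> 0" "\<forall>x\<in>S. a * x \<in> AA h"
    using common_denominator[OF S] by blast
  define V where "V = (*) a ` W"
  have sumV: "(\<Sum>v\<in>V. g v) = (\<Sum>w\<in>W. g (a * w))" for g :: "'a \<Rightarrow> 'a"
    unfolding V_def using a by (subst sum.reindex) (auto simp: inj_on_def)
  have act: "acts V h (a * y)" if y: "y \<in> X \<union> W" for y
    unfolding acts_def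
  proof
    fix v assume "v \<in> V"
    then obtain w where w: "v = a * w" "w \<in> W" by (auto simp: V_def)
    show "\<exists>c. (\<forall>w'\<in>V. c w' \<in> AA h) \<and> a * y * v = (\<Sum>w'\<in>V. c w' * w')"
    proof (intro exI[of _ "\<lambda>v. a * C y w (v / a)"] conjI ballI)
      fix v' assume "v' \<in> V"
      then obtain w' where w': "v' = a * w'" "w' \<in> W" by (auto simp: V_def)
      have "C y w w' \<in> S" using w w' y by (force simp: S_def)
      then show "a * C y w (v' / a) \<in> AA h" using a w' by simp
    next
      have "a * y * v = a * a * (y * w)" by (simp add: w)
      also have "\<dots> = (\<Sum>w'\<in>W. a * C y w w' * (a * w'))"
        unfolding C(2)[OF y w(2)] by (simp add: sum_distrib_left mult_ac)
      also have "\<dots> = (\<Sum>v'\<in>V. a * C y w (v' / a) * v')" using a by (simp add: sumV)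
      finally show "a * y * v = (\<Sum>v'\<in>V. a * C y w (v' / a) * v')" .
    qed
  qed
  have "indep V"
    unfolding indep_def
  proof (intro allI impI)
    fix c assume c: "\<forall>w\<in>V. c w \<in> kk" "(\<Sum>w\<in>V. c w * w) = 0"
    have "(\<Sum>w\<in>V. c w * w) = a * (\<Sum>w\<in>W. c (a * w) * w)"
      by (simp add: sumV sum_distrib_left mult_ac)
    then have "(\<Sum>w\<in>W. c (a * w) * w) = 0" using c a by simp
    moreover have "\<forall>w\<in>W. c (a * w) \<in> kk" using c by (auto simp: V_def)
    ultimately have "\<forall>w\<in>W. c (a * w) = 0"
      using W(4)[unfolded indep_def, rule_format, of "\<lambda>w. c (a * w)"] by blast
    then show "\<forall>w\<in>V. c w = 0" by (auto simp: V_def)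
  qed
  moreover have "finite V" "V \<noteq> {}" using W by (auto simp: V_def)
  moreover have "\<forall>v\<in>V. acts V h v" using act by (auto simp: V_def)
  ultimately show ?thesis using a act by blast
qed

end

section \<open>Sizes of algebraic numbers\<close>

text \<open>By \<open>acts_W\<close> a lattice element with coordinates of degree at most
  \<open>D\<close> acts with degree at most \<open>D + h0\<close>, so solutions found as coordinate
  vectors have controlled size.\<close>

locale lattice = function_field +
  fixes W :: "'a set" and h0 :: nat
  assumes finite_W: "finite W" and W_nonempty: "W \<noteq> {}" and indep_W: "indep W"
    and acts_W: "w \<in> W \<Longrightarrow> acts W h0 w"
begin

definition lat :: "nat \<Rightarrow> 'a set" where
  "lat h = {\<Sum>w\<in>W. c w * w | c. \<forall>w\<in>W. c w \<in> AA h}"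

lemma latI: "(\<And>w. w \<in> W \<Longrightarrow> c w \<in> AA h) \<Longrightarrow> (\<Sum>w\<in>W. c w * w) \<in> lat h"
  unfolding lat_def by blast

lemma latE:
  assumes "z \<in> lat h"
  obtains c where "z = (\<Sum>w\<in>W. c w * w)" "\<And>w. w \<in> W \<Longrightarrow> c w \<in> AA h"
  using assms unfolding lat_def by blast

lemma acts_lat: "acts W h x \<longleftrightarrow> (\<forall>w\<in>W. x * w \<in> lat h)"
  unfolding acts_def lat_def by blast

lemma lat_mono: "z \<in> lat h \<Longrightarrow> h \<le> h' \<Longrightarrow> z \<in> lat h'"
  unfolding lat_def using AA_mono by blast

lemma lat_0: "0 \<in> lat h"
  using latI[of "\<lambda>_. 0" h] by simp

lemma lat_add:
  assumes "x \<in> lat h" "y \<in> lat h"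
  shows "x + y \<in> lat h"
proof -
  obtain c c' where *: "x = (\<Sum>w\<in>W. c w * w)" "y = (\<Sum>w\<in>W. c' w * w)"
    "\<And>w. w \<in> W \<Longrightarrow> c w \<in> AA h" "\<And>w. w \<in> W \<Longrightarrow> c' w \<in> AA h"
    using assms unfolding lat_def by blast
  then have "x + y = (\<Sum>w\<in>W. (c w + c' w) * w)" by (simp add: distrib_right sum.distrib)
  also have "\<dots> \<in> lat h" by (rule latI) (use * in \<open>auto intro: AA_add\<close>)
  finally show ?thesis .
qed

lemma lat_sum: "(\<And>i. i \<in> A \<Longrightarrow> f i \<in> lat h) \<Longrightarrow> sum f A \<in> lat h"
  by (induction A rule: infinite_finite_induct) (auto intro: lat_add lat_0)

lemma lat_scale:
  assumes "a \<in> AA h" "z \<in> lat h'"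
  shows "a * z \<in> lat (h + h')"
proof -
  obtain c where *: "z = (\<Sum>w\<in>W. c w * w)" "\<And>w. w \<in> W \<Longrightarrow> c w \<in> AA h'"
    using assms(2) unfolding lat_def by blast
  have "a * z = (\<Sum>w\<in>W. (a * c w) * w)" by (simp add: *(1) sum_distrib_left mult.assoc)
  also have "\<dots> \<in> lat (h + h')" by (rule latI) (use * assms in \<open>auto intro: AA_mult\<close>)
  finally show ?thesis .
qed

lemma lat_base: "w \<in> W \<Longrightarrow> w \<in> lat h"
  using latI[of "\<lambda>v. if v = w then 1 else 0" h] finite_W
  by (simp add: if_distrib[of "\<lambda>x. x * _"] cong: if_cong)

lemma acts_mult_lat:
  assumes "acts W h x" "z \<in> lat h'"
  shows "x * z \<in> lat (h' + h)"
proof -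
  obtain c where *: "z = (\<Sum>w\<in>W. c w * w)" "\<And>w. w \<in> W \<Longrightarrow> c w \<in> AA h'"
    using assms(2) unfolding lat_def by blast
  have "x * z = (\<Sum>w\<in>W. c w * (x * w))"
    by (simp add: *(1) sum_distrib_left mult.left_commute)
  also have "\<dots> \<in> lat (h' + h)"
    using * assms(1) by (intro lat_sum lat_scale) (auto simp: acts_lat)
  finally show ?thesis .
qed

lemma acts_mono: "acts W h x \<Longrightarrow> h \<le> h' \<Longrightarrow> acts W h' x"
  using lat_mono by (auto simp: acts_lat)

lemma acts_add: "acts W h x \<Longrightarrow> acts W h y \<Longrightarrow> acts W h (x + y)"
  by (auto simp: acts_lat distrib_right intro: lat_add)

lemma acts_mult: "acts W h x \<Longrightarrow> acts W h' y \<Longrightarrow> acts W (h + h') (x * y)"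
  using acts_mult_lat[of h x _ h'] by (auto simp: acts_lat mult.assoc add.commute)

lemma acts_AA: "x \<in> AA h \<Longrightarrow> acts W h x"
  using lat_scale[OF _ lat_base[of _ 0]] by (auto simp: acts_lat)

lemma acts_power: "acts W h x \<Longrightarrow> acts W (n * h) (x ^ n)"
  by (induction n) (auto intro: acts_AA acts_mult)

lemma acts_sum: "(\<And>i. i \<in> A \<Longrightarrow> acts W h (f i)) \<Longrightarrow> acts W h (sum f A)"
  by (induction A rule: infinite_finite_induct) (auto intro: acts_add acts_AA)

lemma W_nonzero: "w \<in> W \<Longrightarrow> w \<noteq> 0"
proof
  assume w: "w \<in> W" "w = 0"
  let ?c = "\<lambda>v. if v = w then 1 else 0 :: 'a"
  have "(\<Sum>v\<in>W. ?c v * v) = 0" using w by (intro sum.neutral) auto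
  moreover have "\<forall>v\<in>W. ?c v \<in> kk" using kk_closed(1,2) by auto
  ultimately have "?c w = 0" using indep_W[unfolded indep_def, rule_format, of ?c w] w(1) by blast
  then show False by simp
qed

lemma indep_AA:
  assumes "\<And>w. w \<in> W \<Longrightarrow> c w \<in> AA h" "(\<Sum>w\<in>W. c w * w) = 0" "w \<in> W"
  shows "c w = 0"
  using indep_W AA_kfield assms unfolding indep_def by blast

lemma acts_algebraic: "acts W h x \<Longrightarrow> x \<in> kbar q T"
proof -
  assume x: "acts W h x"
  obtain w where w: "w \<in> W" using W_nonempty by blast
  have "x \<in> stab W"
    using x AA_kfield unfolding acts_def stab_def kspan_def by blast
  then show ?thesis using stab_algebraic[OF finite_W w W_nonzero[OF w]] by blast
qed

definition size_W :: real where "size_W = Max (nv ` W)"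

lemma nv_W_le: "w \<in> W \<Longrightarrow> nv w \<le> size_W"
  unfolding size_W_def using finite_W by (intro Max_ge) auto

lemma size_W_attained: "\<exists>w\<in>W. nv w = size_W"
proof -
  have "Max (nv ` W) \<in> nv ` W" using finite_W W_nonempty by (intro Max_in) auto
  then show ?thesis unfolding size_W_def by force
qed

lemma size_W_pos: "size_W > 0"
  using size_W_attained W_nonzero nv_pos by metis

lemma nv_lat: "z \<in> lat h \<Longrightarrow> nv z \<le> real q ^ h * size_W"
proof (elim latE)
  fix c assume c: "z = (\<Sum>w\<in>W. c w * w)" "\<And>w. w \<in> W \<Longrightarrow> c w \<in> AA h"
  show ?thesis unfolding c(1)
    by (rule nv_sum_le)
      (use c(2) size_W_pos in \<open>auto simp: nv_mult intro!: mult_mono nv_AA_le nv_W_le nv_nonneg\<close>)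
qed

text \<open>Tested on a basis element of maximal absolute value, the factor \<open>size_W\<close>
  cancels. A bound free of constants passes unchanged to \<open>q ^ M\<close>-th roots.\<close>

lemma nv_acts: "acts W h x \<Longrightarrow> nv x \<le> real q ^ h"
proof -
  assume x: "acts W h x"
  obtain w where w: "w \<in> W" "nv w = size_W" using size_W_attained by blast
  then have "nv (x * w) \<le> real q ^ h * size_W" using x by (intro nv_lat) (simp add: acts_lat)
  then show ?thesis using w size_W_pos by (simp add: nv_mult)
qed

text \<open>Siegel's lemma provides a small nonzero \<open>z\<close> in the lattice such that \<open>x z\<close> is a polynomial multiple
  of a single basis element.\<close>

lemma acts_liouville:
  "\<exists>\<kappa>>0. \<kappa> \<le> 1 \<and> (\<forall>h x. acts W h x \<longrightarrow> x \<noteq> 0 \<longrightarrow> nv x * real q ^ (card W * h) \<ge> \<kappa>)"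
proof -
  obtain w0 where w0: "w0 \<in> W" using W_nonempty by blast
  define \<kappa> where "\<kappa> = nv w0 / size_W"
  have "nv x * real q ^ (card W * h) \<ge> \<kappa>" if x: "acts W h x" "x \<noteq> 0" for h x
  proof -
    have "\<exists>c. (\<forall>w'\<in>W. c w' \<in> AA h) \<and> x * w = (\<Sum>w'\<in>W. c w' * w')" if "w \<in> W" for w
      using x(1) that unfolding acts_def by blast
    then obtain C where C: "\<And>w w'. w \<in> W \<Longrightarrow> w' \<in> W \<Longrightarrow> C w w' \<in> AA h"
      "\<And>w. w \<in> W \<Longrightarrow> x * w = (\<Sum>w'\<in>W. C w w' * w')" by metis
    \<comment> \<open>There is one equation for each basis element other than \<open>w0\<close>, so
      the count only asks for \<open>D\<close> to be at least
      \<open>(card W - 1) * h\<close>.\<close>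
    define D where "D = card W * h"
    have "card W > 0" using finite_W W_nonempty by (simp add: card_gt_0_iff)
    then obtain d where d: "card W = Suc d" using gr0_implies_Suc by blast
    have "\<exists>y. (\<forall>w\<in>W. y w \<in> AA D) \<and> (\<exists>w\<in>W. y w \<noteq> 0) \<and>
        (\<forall>w'\<in>W - {w0}. (\<Sum>w\<in>W. C w w' * y w) = 0)"
      by (rule siegel_AA[where h = h]) (use finite_W w0 C d in \<open>auto simp: D_def algebra_simps\<close>)
    then obtain y where y: "\<forall>w\<in>W. y w \<in> AA D" "\<exists>w\<in>W. y w \<noteq> 0"
        "\<forall>w'\<in>W - {w0}. (\<Sum>w\<in>W. C w w' * y w) = 0" by blast
    define z where "z = (\<Sum>w\<in>W. y w * w)"
    define b where "b = (\<Sum>w\<in>W. C w w0 * y w)"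
    have z0: "z \<noteq> 0" using indep_AA[of y D] y unfolding z_def by blast
    have "x * z = (\<Sum>w\<in>W. y w * (x * w))"
      by (simp add: z_def sum_distrib_left mult.left_commute)
    also have "\<dots> = (\<Sum>w\<in>W. \<Sum>w'\<in>W. C w w' * y w * w')"
      by (intro sum.cong refl) (subst C(2), assumption, simp add: sum_distrib_left mult_ac)
    also have "\<dots> = (\<Sum>w'\<in>W. (\<Sum>w\<in>W. C w w' * y w) * w')"
      by (subst sum.swap) (simp add: sum_distrib_right)
    also have "\<dots> = b * w0"
      using sum.remove[OF finite_W w0, of "\<lambda>w'. (\<Sum>w\<in>W. C w w' * y w) * w'"] y(3)
      by (simp add: b_def)
    finally have xz: "x * z = b * w0" .
    have "b \<in> AA (h + D)" unfolding b_def using C y w0 by (intro AA_sum AA_mult) auto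
    moreover have "b \<noteq> 0" using xz x z0 by auto
    ultimately have "1 \<le> nv b" by (rule nv_AA_ge)
    then have "nv w0 \<le> nv b * nv w0" using nv_nonneg[of w0] by (simp add: mult_le_cancel_right1)
    also have "\<dots> = nv x * nv z" using xz by (metis nv_mult)
    also have "\<dots> \<le> nv x * (real q ^ D * size_W)"
      using y nv_lat[of z D] nv_nonneg by (intro mult_left_mono) (auto simp: z_def intro: latI)
    finally show ?thesis using size_W_pos by (simp add: \<kappa>_def D_def field_simps)
  qed
  moreover have "\<kappa> > 0" "\<kappa> \<le> 1"
    using nv_pos[OF W_nonzero[OF w0]] size_W_pos nv_W_le[OF w0] by (auto simp: \<kappa>_def)
  ultimately show ?thesis by blast
qed

text \<open>Inverse twists leave every finite extension, by purely inseparable elements, but the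
  logarithmic size below, which is normalised by passing to \<open>q\<close>-powers, does not grow under \<open>q\<close>-th roots.\<close>

definition sz :: "nat \<Rightarrow> 'a \<Rightarrow> bool" where
  "sz b x \<longleftrightarrow> (\<exists>M. acts W (b * q ^ M) (x ^ (q ^ M)))"

lemma acts_frob_mono:
  assumes "acts W (b * q ^ M) (x ^ (q ^ M))" "M \<le> N"
  shows "acts W (b * q ^ N) (x ^ (q ^ N))"
  using assms(2)
proof (induction N rule: dec_induct)
  case (step N)
  have "x ^ (q ^ Suc N) = (x ^ (q ^ N)) ^ q" by (metis power_Suc2 power_mult)
  with acts_power[OF step.IH, of q] show ?case by (simp add: mult.left_commute)
qed (rule assms)

lemma szE:
  assumes "sz b x"
  obtains M where "\<And>N. N \<ge> M \<Longrightarrow> acts W (b * q ^ N) (x ^ (q ^ N))"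
proof -
  obtain M where "acts W (b * q ^ M) (x ^ (q ^ M))" using assms unfolding sz_def by blast
  then show thesis using that acts_frob_mono by metis
qed

lemma sz_mono: "sz b x \<Longrightarrow> b \<le> b' \<Longrightarrow> sz b' x"
  unfolding sz_def by (elim exE, rule exI, erule acts_mono) simp

lemma sz_AA: "x \<in> AA b \<Longrightarrow> sz b x"
  unfolding sz_def using acts_AA by (intro exI[of _ 0]) simp

lemma sz_acts: "acts W b x \<Longrightarrow> sz b x"
  unfolding sz_def by (intro exI[of _ 0]) simp

lemma sz_0 [simp]: "sz b 0" and sz_1 [simp]: "sz b 1"
  by (auto intro: sz_AA)

lemma sz_add: "sz b x \<Longrightarrow> sz b y \<Longrightarrow> sz b (x + y)"
proof (elim szE)
  fix M N assume "\<And>N. N \<ge> M \<Longrightarrow> acts W (b * q ^ N) (x ^ (q ^ N))"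
    "\<And>M. M \<ge> N \<Longrightarrow> acts W (b * q ^ M) (y ^ (q ^ M))"
  then show "sz b (x + y)" unfolding sz_def
    by (intro exI[of _ "max M N"]) (unfold frob_pow_add, intro acts_add, auto)
qed

lemma sz_mult: "sz b x \<Longrightarrow> sz b' y \<Longrightarrow> sz (b + b') (x * y)"
proof (elim szE)
  fix M N assume "\<And>N. N \<ge> M \<Longrightarrow> acts W (b * q ^ N) (x ^ (q ^ N))"
    "\<And>M. M \<ge> N \<Longrightarrow> acts W (b' * q ^ M) (y ^ (q ^ M))"
  then show "sz (b + b') (x * y)" unfolding sz_def
    by (intro exI[of _ "max M N"]) (unfold power_mult_distrib distrib_right, intro acts_mult, auto)
qed

lemma sz_sum: "(\<And>i. i \<in> A \<Longrightarrow> sz b (f i)) \<Longrightarrow> sz b (sum f A)"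
  by (induction A rule: infinite_finite_induct) (auto intro: sz_add)

lemma sz_uminus: "sz b x \<Longrightarrow> sz b (- x)"
  using sz_mult[OF sz_AA[OF AA_uminus[OF AA_1[of 0]]], of b x] by simp

lemma sz_power: "sz b x \<Longrightarrow> sz (n * b) (x ^ n)"
  by (induction n) (auto intro: sz_mult)

text \<open>The power \<open>q ^ Suc M\<close> of \<open>\<phi> x\<close> is the power
  \<open>q ^ M\<close> of \<open>x\<close>: the witness moves up by one, and the allowed degree only
  grows.\<close>

lemma sz_frob_inv: "sz b x \<Longrightarrow> sz b (\<phi> x)"
proof -
  assume "sz b x"
  then obtain M where "acts W (b * q ^ M) (x ^ (q ^ M))" unfolding sz_def by blast
  moreover have "b * q ^ M \<le> b * q ^ Suc M"
    by (intro mult_le_mono2 power_increasing) (simp_all add: Suc_le_eq)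
  ultimately have "acts W (b * q ^ Suc M) (x ^ (q ^ M))" by (rule acts_mono)
  moreover have "\<phi> x ^ (q ^ Suc M) = x ^ (q ^ M)"
    by (simp only: power_Suc power_mult frob_inv_pow)
  ultimately have "acts W (b * q ^ Suc M) (\<phi> x ^ (q ^ Suc M))" by (simp only:)
  then show ?thesis unfolding sz_def by blast
qed

lemma nv_sz: "sz b x \<Longrightarrow> nv x \<le> real q ^ b"
proof -
  assume "sz b x"
  then obtain M where "acts W (b * q ^ M) (x ^ (q ^ M))" unfolding sz_def by blast
  from nv_acts[OF this] have "nv x ^ (q ^ M) \<le> (real q ^ b) ^ (q ^ M)"
    by (simp add: nv_power power_mult)
  then show ?thesis using nv_nonneg[of x] by simp
qed

text \<open>Only a power of \<open>x\<close> acts on the lattice; composing its annihilating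
  polynomial with that power of the variable gives one for \<open>x\<close>.\<close>

lemma sz_algebraic: "sz b x \<Longrightarrow> x \<in> kbar q T"
proof -
  assume "sz b x"
  then obtain M where "x ^ (q ^ M) \<in> kbar q T" unfolding sz_def using acts_algebraic by blast
  then obtain f where f: "f \<noteq> 0" "f \<in> polys_over kk" "poly f (x ^ (q ^ M)) = 0"
    unfolding kbar_def algebraic_over_def polys_over_def by blast
  let ?g = "pcompose f (monom 1 (q ^ M))"
  have "degree (monom (1 :: 'a) (q ^ M)) > 0" by (simp add: degree_monom_eq)
  then have "?g \<noteq> 0" using f(1) pcompose_eq_0 by blast
  moreover have "?g \<in> polys_over kk"
    by (intro polys_over_pcompose polys_over_closed kfield_subfield f kk_closed)
  moreover have "poly ?g x = 0" using f(3) by (simp add: poly_pcompose poly_monom)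
  ultimately show ?thesis unfolding kbar_def algebraic_over_def polys_over_def by blast
qed

text \<open>The estimate is known for \<open>x ^ (q ^ M)\<close> with \<open>M\<close> out of
  control. It descends with the same constant because \<open>\<kappa> \<le> 1\<close>: a quantity
  below \<open>\<kappa>\<close> has powers no larger than itself.\<close>

lemma sz_liouville:
  "\<exists>\<kappa>>0. \<forall>b x. sz b x \<longrightarrow> x \<noteq> 0 \<longrightarrow> nv x * real q ^ (card W * b) \<ge> \<kappa>"
proof -
  obtain \<kappa> where \<kappa>: "\<kappa> > 0" "\<kappa> \<le> 1"
    "\<And>h x. acts W h x \<Longrightarrow> x \<noteq> 0 \<Longrightarrow> nv x * real q ^ (card W * h) \<ge> \<kappa>"
    using acts_liouville by blast
  have "nv x * real q ^ (card W * b) \<ge> \<kappa>" if x: "sz b x" "x \<noteq> 0" for b x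
  proof (rule ccontr)
    let ?y = "nv x * real q ^ (card W * b)"
    assume less: "\<not> ?y \<ge> \<kappa>"
    obtain M where "acts W (b * q ^ M) (x ^ (q ^ M))" using x(1) unfolding sz_def by blast
    from \<kappa>(3)[OF this] x(2) have "\<kappa> \<le> nv x ^ (q ^ M) * real q ^ (card W * (b * q ^ M))"
      by (simp add: nv_power)
    also have "\<dots> = ?y ^ (q ^ M)"
      by (simp only: power_mult_distrib power_mult mult.assoc[symmetric])
    also have "\<dots> \<le> ?y ^ 1"
      using less \<kappa>(2) nv_nonneg[of x] by (intro power_decreasing) (auto simp: Suc_le_eq)
    finally show False using less by simp
  qed
  then show ?thesis using \<kappa>(1) by blast
qed

lemma frob_inv_funpow: "((\<phi> ^^ M) x) ^ (q ^ M) = x"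
proof (induction M)
  case (Suc M)
  then show ?case by (simp add: power_mult)
qed simp

text \<open>After a common power \<open>q ^ M\<close> all coefficients act on the lattice, which
  gives a system over polynomials in \<open>T\<close>; by additivity of Frobenius,
  \<open>q ^ M\<close>-th roots of its solution solve the original system. The bound involves only
  the ratio \<open>c\<close> of equations to surplus unknowns, not their numbers.\<close>

lemma siegel:
  assumes "finite I" "finite J" "card I < card J" and c: "card I \<le> c * (card J - card I)"
    and a: "\<And>i j. i \<in> I \<Longrightarrow> j \<in> J \<Longrightarrow> sz b (a i j)"
  shows "\<exists>y. (\<forall>j\<in>J. sz (c * b + h0) (y j)) \<and> (\<exists>j\<in>J. y j \<noteq> 0) \<and>
    (\<forall>i\<in>I. (\<Sum>j\<in>J. a i j * y j) = 0)"
proof -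
  have "\<exists>M. \<forall>N\<ge>M. acts W (b * q ^ N) (a i j ^ (q ^ N))" if "i \<in> I" "j \<in> J" for i j
    using szE[OF a[OF that]] by metis
  then obtain M0 where M0: "\<And>i j N. i \<in> I \<Longrightarrow> j \<in> J \<Longrightarrow> N \<ge> M0 i j \<Longrightarrow>
      acts W (b * q ^ N) (a i j ^ (q ^ N))" by metis
  \<comment> \<open>The sum serves as an upper bound for all \<open>M0 i j\<close>.\<close>
  define M where "M = (\<Sum>i\<in>I. \<Sum>j\<in>J. M0 i j)"
  have "M0 i j \<le> M" if "i \<in> I" "j \<in> J" for i j
    using member_le_sum[of j J "\<lambda>j. M0 i j"] member_le_sum[of i I "\<lambda>i. \<Sum>j\<in>J. M0 i j"]
      that assms(1,2) unfolding M_def by fastforce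
  then have act: "acts W (b * q ^ M) (a i j ^ (q ^ M))" if "i \<in> I" "j \<in> J" for i j
    using that M0 by blast
  define h where "h = b * q ^ M"
  define D where "D = c * h"
  define is_row where "is_row i j w c \<longleftrightarrow>
    (\<forall>w'\<in>W. c w' \<in> AA h) \<and> a i j ^ (q ^ M) * w = (\<Sum>w'\<in>W. c w' * w')" for i j w c
  define C where "C i j w = (SOME c. is_row i j w c)" for i j w
  have row: "is_row i j w (C i j w)" if "i \<in> I" "j \<in> J" "w \<in> W" for i j w
  proof -
    have "acts W h (a i j ^ (q ^ M))" using act[OF that(1,2)] by (simp only: h_def)
    then have "\<exists>c. is_row i j w c" using that(3) unfolding acts_def is_row_def by (rule bspec)
    then show ?thesis unfolding C_def by (rule someI_ex)
  qed
  have C: "C i j w w' \<in> AA h" if "i \<in> I" "j \<in> J" "w \<in> W" "w' \<in> W" for i j w w'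
    using row[OF that(1-3)] that(4) unfolding is_row_def by blast
  have C_eq: "a i j ^ (q ^ M) * w = (\<Sum>w'\<in>W. C i j w w' * w')"
    if "i \<in> I" "j \<in> J" "w \<in> W" for i j w
    using row[OF that] unfolding is_row_def by blast
  have d: "card W > 0" using finite_W W_nonempty by (simp add: card_gt_0_iff)
  have less: "card I * (D + h + 1) < card J * (D + 1)"
  proof -
    obtain k where k: "card J = card I + k" "k > 0"
      using less_imp_add_positive[OF assms(3)] by metis
    have "card I \<le> c * k" using c unfolding k(1) by simp
    then have "card I * h \<le> c * k * h" by (rule mult_le_mono1)
    moreover have "card J * (D + 1) = card I * (D + 1) + c * k * h + k"
      unfolding k(1) D_def by (simp only: algebra_simps)
    moreover have "card I * (D + h + 1) = card I * (D + 1) + card I * h"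
      by (simp only: algebra_simps)
    ultimately show ?thesis using k(2) by linarith
  qed
  have "\<exists>y. (\<forall>jw\<in>J \<times> W. y jw \<in> AA D) \<and> (\<exists>jw\<in>J \<times> W. y jw \<noteq> 0) \<and>
     (\<forall>iw\<in>I \<times> W. (\<Sum>jw\<in>J \<times> W. C (fst iw) (fst jw) (snd jw) (snd iw) * y jw) = 0)"
  proof (rule siegel_AA[where h = h])
    show "card (I \<times> W) * (D + h + 1) < card (J \<times> W) * (D + 1)"
      using mult_less_mono2[OF less d] by (simp only: card_cartesian_product mult_ac)
  qed (use assms finite_W C in auto)
  then obtain y where y: "\<forall>jw\<in>J \<times> W. y jw \<in> AA D" "\<exists>jw\<in>J \<times> W. y jw \<noteq> 0"
    "\<forall>iw\<in>I \<times> W. (\<Sum>jw\<in>J \<times> W. C (fst iw) (fst jw) (snd jw) (snd iw) * y jw) = 0"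
    by blast
  have y0: "(\<Sum>jw\<in>J \<times> W. C i (fst jw) (snd jw) w' * y jw) = 0" if "i \<in> I" "w' \<in> W" for i w'
    using bspec[OF y(3), of "(i, w')"] that by simp
  define Y where "Y j = (\<Sum>w\<in>W. y (j, w) * w)" for j
  define P where "P j = (\<phi> ^^ M) (Y j)" for j
  have PY: "P j ^ (q ^ M) = Y j" for j unfolding P_def by (rule frob_inv_funpow)
  show ?thesis
  proof (intro exI[of _ P] conjI ballI)
    fix j assume j: "j \<in> J"
    have "acts W (D + h0) (Y j)"
      unfolding Y_def using y(1) j by (intro acts_sum acts_mult acts_AA acts_W) auto
    moreover have "D + h0 \<le> (c * b + h0) * q ^ M"
    proof -
      have "1 \<le> q ^ M" by (simp add: Suc_le_eq)
      from mult_le_mono2[OF this, of h0] show ?thesis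
        by (simp only: D_def h_def add_mult_distrib mult.assoc mult_1_right add_le_cancel_left)
    qed
    ultimately show "sz (c * b + h0) (P j)"
      unfolding sz_def using PY acts_mono by metis
  next
    obtain j w where jw: "j \<in> J" "w \<in> W" "y (j, w) \<noteq> 0" using y(2) by auto
    then have "Y j \<noteq> 0" using indep_AA[of "\<lambda>w. y (j, w)" D w] y(1) unfolding Y_def by auto
    then have "P j \<noteq> 0" using PY[of j] by (auto simp: power_0_left)
    then show "\<exists>j\<in>J. P j \<noteq> 0" using jw by blast
  next
    fix i assume i: "i \<in> I"
    have "(\<Sum>j\<in>J. a i j * P j) ^ (q ^ M) = (\<Sum>j\<in>J. a i j ^ (q ^ M) * Y j)"
      by (simp add: frob_pow_sum power_mult_distrib PY)
    also have "\<dots> = (\<Sum>j\<in>J. \<Sum>w\<in>W. y (j, w) * (a i j ^ (q ^ M) * w))"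
      by (simp add: Y_def sum_distrib_left mult.left_commute)
    also have "\<dots> = (\<Sum>j\<in>J. \<Sum>w\<in>W. \<Sum>w'\<in>W. C i j w w' * y (j, w) * w')"
      by (intro sum.cong refl) (subst C_eq[OF i], assumption+, simp add: sum_distrib_left mult_ac)
    also have "\<dots> = (\<Sum>jw\<in>J \<times> W. \<Sum>w'\<in>W. C i (fst jw) (snd jw) w' * y jw * w')"
      by (subst sum.cartesian_product) (simp only: case_prod_unfold prod.collapse)
    also have "\<dots> = (\<Sum>w'\<in>W. (\<Sum>jw\<in>J \<times> W. C i (fst jw) (snd jw) w' * y jw) * w')"
      by (subst sum.swap) (simp add: sum_distrib_right)
    also have "\<dots> = 0" using y0[OF i] by simp
    finally show "(\<Sum>j\<in>J. a i j * P j) = 0" by simp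
  qed
qed

end

context function_field
begin

section \<open>Evaluation of power series and the Schwarz lemma\<close>

text \<open>A relational companion of \<open>series_eval\<close>: sums, products and twists
  transport it without a prior proof that a value exists.\<close>

definition evals :: "'a fps \<Rightarrow> 'a \<Rightarrow> 'a \<Rightarrow> bool" where
  "evals f x s \<longleftrightarrow> (\<lambda>N. nv (s - (\<Sum>n<N. fps_nth f n * x ^ n))) \<longlonglongrightarrow> 0"

text \<open>The Gauss norm of \<open>f\<close> at radius \<open>R\<close> is at most
  \<open>C\<close>.\<close>

definition bounded_by :: "'a fps \<Rightarrow> real \<Rightarrow> real \<Rightarrow> bool" where
  "bounded_by f R C \<longleftrightarrow> (\<forall>n. nv (fps_nth f n) * R ^ n \<le> C)"

lemma nv_triangle: "nv (x + y) \<le> nv x + nv y"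
  using nv_ultra[of x y] nv_nonneg[of x] nv_nonneg[of y] by linarith

lemma nv_minus_commute: "nv (x - y) = nv (y - x)"
  using nv_uminus[of "x - y"] by simp

lemma nv_tendsto_0_le:
  assumes "X \<longlonglongrightarrow> 0" "\<And>n. nv (Y n) \<le> X n"
  shows "(\<lambda>n. nv (Y n)) \<longlonglongrightarrow> 0"
  by (rule tendsto_sandwich[OF _ _ tendsto_const assms(1)]) (auto simp: nv_nonneg assms(2))

lemma evals_unique: "evals f x s \<Longrightarrow> evals f x t \<Longrightarrow> s = t"
proof -
  assume *: "evals f x s" "evals f x t"
  have "(\<lambda>N::nat. nv (s - t)) \<longlonglongrightarrow> 0"
  proof (rule nv_tendsto_0_le)
    show "(\<lambda>N. nv (s - (\<Sum>n<N. fps_nth f n * x ^ n)) + nv (t - (\<Sum>n<N. fps_nth f n * x ^ n))) \<longlonglongrightarrow> 0"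
      using tendsto_add[OF *[unfolded evals_def]] by simp
    show "nv (s - t) \<le> nv (s - (\<Sum>n<N. fps_nth f n * x ^ n)) + nv (t - (\<Sum>n<N. fps_nth f n * x ^ n))" for N
      using nv_triangle[of "s - (\<Sum>n<N. fps_nth f n * x ^ n)" "(\<Sum>n<N. fps_nth f n * x ^ n) - t"]
      by (simp add: nv_minus_commute)
  qed
  then have "nv (s - t) = 0" by (simp add: LIMSEQ_const_iff)
  then show ?thesis by (simp add: nv_zero_iff)
qed

lemma evals_0: "evals 0 x 0"
  unfolding evals_def by simp

lemma evals_add:
  assumes "evals f x s" "evals g x t"
  shows "evals (f + g) x (s + t)"
  unfolding evals_def
proof (rule nv_tendsto_0_le)
  show "(\<lambda>N. nv (s - (\<Sum>n<N. fps_nth f n * x ^ n)) + nv (t - (\<Sum>n<N. fps_nth g n * x ^ n))) \<longlonglongrightarrow> 0"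
    using tendsto_add[OF assms[unfolded evals_def]] by simp
  show "nv (s + t - (\<Sum>n<N. fps_nth (f + g) n * x ^ n))
      \<le> nv (s - (\<Sum>n<N. fps_nth f n * x ^ n)) + nv (t - (\<Sum>n<N. fps_nth g n * x ^ n))" for N
    using nv_triangle[of "s - (\<Sum>n<N. fps_nth f n * x ^ n)" "t - (\<Sum>n<N. fps_nth g n * x ^ n)"]
    by (simp add: distrib_right sum.distrib algebra_simps)
qed

lemma evals_sum:
  "(\<And>i. i \<in> A \<Longrightarrow> evals (f i) x (s i)) \<Longrightarrow> evals (\<Sum>i\<in>A. f i) x (\<Sum>i\<in>A. s i)"
  by (induction A rule: infinite_finite_induct) (auto intro: evals_add evals_0)

lemma evals_const_mult:
  assumes "evals f x s"
  shows "evals (fps_const c * f) x (c * s)"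
proof -
  have "nv (c * s - (\<Sum>n<N. fps_nth (fps_const c * f) n * x ^ n))
      = nv c * nv (s - (\<Sum>n<N. fps_nth f n * x ^ n))" for N
    by (simp add: nv_mult[symmetric] right_diff_distrib sum_distrib_left mult.assoc)
  then show ?thesis
    using tendsto_mult_left[OF assms[unfolded evals_def], of "nv c"] unfolding evals_def by simp
qed

lemma evals_X_mult:
  assumes "evals f x s"
  shows "evals (fps_X * f) x (x * s)"
proof -
  have *: "nv (x * s - (\<Sum>n<Suc N. fps_nth (fps_X * f) n * x ^ n))
      = nv x * nv (s - (\<Sum>n<N. fps_nth f n * x ^ n))" for N
    by (simp add: nv_mult[symmetric] right_diff_distrib sum_distrib_left sum.lessThan_Suc_shift
        mult.left_commute del: sum.lessThan_Suc)
  show ?thesis unfolding evals_def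
    by (subst filterlim_sequentially_Suc[symmetric], unfold *)
      (use tendsto_mult_left[OF assms[unfolded evals_def], of "nv x"] in simp)
qed

lemma evals_poly_mult:
  assumes "evals f x s"
  shows "evals (fps_of_poly P * f) x (poly P x * s)"
proof (induction P)
  case 0
  then show ?case by (simp add: evals_0)
next
  case (pCons a P)
  have "fps_of_poly (pCons a P) * f = fps_const a * f + fps_X * (fps_of_poly P * f)"
    by (simp add: fps_of_poly_pCons algebra_simps)
  with evals_add[OF evals_const_mult[OF assms] evals_X_mult[OF pCons.IH]] show ?case
    by (simp add: algebra_simps)
qed

section \<open>Inverse twists of series and polynomials\<close>

lemma twist_inv_nth [simp]: "fps_nth (twist_inv q f) n = \<phi> (fps_nth f n)"
  by (simp add: twist_inv_def)

lemma twist_inv_add: "twist_inv q ((f :: 'a fps) + g) = twist_inv q f + twist_inv q g"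
  by (rule fps_ext) (simp add: frob_inv_add)

lemma twist_inv_mult: "twist_inv q ((f :: 'a fps) * g) = twist_inv q f * twist_inv q g"
  by (rule fps_ext) (simp add: fps_mult_nth frob_inv_sum frob_inv_mult)

lemma twist_inv_0 [simp]: "twist_inv q (0 :: 'a fps) = 0"
  by (rule fps_ext) simp

lemma twist_inv_sum: "twist_inv q (\<Sum>i\<in>A. f i :: 'a fps) = (\<Sum>i\<in>A. twist_inv q (f i))"
  by (induction A rule: infinite_finite_induct) (auto simp: twist_inv_add)

lemma twist_inv_of_poly: "twist_inv q (fps_of_poly P) = fps_of_poly (map_poly \<phi> P)"
  by (rule fps_ext) (simp add: coeff_map_poly)

lemma twist_inv_eq_0_iff [simp]: "twist_inv q f = 0 \<longleftrightarrow> f = (0 :: 'a fps)"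
  by (auto simp: fps_eq_iff)

lemma poly_map_frob_inv: "poly (map_poly \<phi> P) (\<phi> x) = \<phi> (poly P x)"
proof (induction P)
  case (pCons a P)
  then show ?case
    by (cases "pCons a P = 0") (auto simp: map_poly_pCons frob_inv_add frob_inv_mult)
qed simp

text \<open>The remainders become their exact \<open>q\<close>-th roots, and the real root is
  continuous at 0.\<close>

lemma evals_twist_inv:
  assumes "evals f x s"
  shows "evals (twist_inv q f) (\<phi> x) (\<phi> s)"
proof -
  have "nv (\<phi> s - (\<Sum>n<N. fps_nth (twist_inv q f) n * \<phi> x ^ n))
      = root q (nv (s - (\<Sum>n<N. fps_nth f n * x ^ n)))" for N
    by (simp add: nv_frob_inv_root[symmetric] frob_inv_diff frob_inv_sum frob_inv_mult frob_inv_power)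
  then show ?thesis
    using tendsto_real_root[OF assms[unfolded evals_def], of q] unfolding evals_def by simp
qed

section \<open>Gauss norms and division by zeros\<close>

lemma bounded_by_nonneg: "bounded_by f R C \<Longrightarrow> C \<ge> 0"
  unfolding bounded_by_def using nv_nonneg[of "fps_nth f 0"] by (metis mult.right_neutral order_trans power_0)

lemma bounded_by_term:
  assumes "bounded_by f R C" "R > 0"
  shows "nv (fps_nth f n * x ^ n) \<le> C * (nv x / R) ^ n"
proof -
  have "nv (fps_nth f n * x ^ n) = (nv (fps_nth f n) * R ^ n) * (nv x / R) ^ n"
    using assms(2) by (simp add: nv_mult nv_power power_divide)
  also have "\<dots> \<le> C * (nv x / R) ^ n"
    using assms nv_nonneg[of x] unfolding bounded_by_def by (intro mult_right_mono) auto
  finally show ?thesis .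
qed

lemma bounded_by_block:
  assumes "bounded_by f R C" "R > 0" "nv x \<le> R"
  shows "nv (\<Sum>n\<in>{k..<N}. fps_nth f n * x ^ n) \<le> C * (nv x / R) ^ k"
proof (rule nv_sum_le)
  fix n assume "n \<in> {k..<N}"
  then have "(nv x / R) ^ n \<le> (nv x / R) ^ k"
    using assms nv_nonneg[of x] by (intro power_decreasing) auto
  then show "nv (fps_nth f n * x ^ n) \<le> C * (nv x / R) ^ k"
    using bounded_by_term[OF assms(1,2), of n x] bounded_by_nonneg[OF assms(1)]
    by (meson mult_left_mono order_trans)
qed (use bounded_by_nonneg[OF assms(1)] nv_nonneg[of x] assms in auto)

lemma lessThan_split: "(k :: nat) \<le> N \<Longrightarrow> (\<Sum>n<N. f n) = (\<Sum>n<k. f n) + (\<Sum>n\<in>{k..<N}. f n :: 'a)"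
  using sum.atLeastLessThan_concat[of 0 k N f] by (simp add: atLeast0LessThan)

lemma bounded_by_evals:
  assumes f: "bounded_by f R C" "R > 0" "nv x < R"
  shows "\<exists>s. evals f x s"
proof -
  define X where "X N = (\<Sum>n<N. fps_nth f n * x ^ n)" for N
  define b where "b N = C * (nv x / R) ^ N" for N
  have b: "b \<longlonglongrightarrow> 0" unfolding b_def
    using f nv_nonneg[of x] by (intro tendsto_mult_right_zero LIMSEQ_realpow_zero) auto
  have diff: "nv (X m - X n) \<le> b N" if "N \<le> n" "n \<le> m" for m n N
  proof -
    have "X m - X n = (\<Sum>i\<in>{n..<m}. fps_nth f i * x ^ i)"
      unfolding X_def using lessThan_split[OF that(2)] by simp
    then have "nv (X m - X n) \<le> C * (nv x / R) ^ n"
      using bounded_by_block[OF f(1,2), of x n m] f(3) by simp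
    also have "\<dots> \<le> b N" unfolding b_def
      using f that bounded_by_nonneg[OF f(1)] nv_nonneg[of x]
      by (intro mult_left_mono power_decreasing) auto
    finally show ?thesis .
  qed
  have "\<forall>e>0. \<exists>N. \<forall>m\<ge>N. \<forall>n\<ge>N. nv (X m - X n) < e"
  proof (intro allI impI)
    fix e :: real assume "e > 0"
    then obtain N where N: "b N < e"
      using order_tendstoD(2)[OF b] by (metis eventually_sequentially order_refl)
    have "nv (X m - X n) < e" if "m \<ge> N" "n \<ge> N" for m n
    proof (cases "n \<le> m")
      case True
      then show ?thesis using diff[of N n m] that N by linarith
    next
      case False
      then show ?thesis using diff[of N m n] that N nv_minus_commute[of "X m" "X n"] by linarith
    qed
    then show "\<exists>N. \<forall>m\<ge>N. \<forall>n\<ge>N. nv (X m - X n) < e" by blast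
  qed
  then obtain L where "(\<lambda>n. nv (X n - L)) \<longlonglongrightarrow> 0" using complete by blast
  then have "evals f x L" unfolding evals_def X_def by (simp add: nv_minus_commute)
  then show ?thesis by blast
qed

text \<open>For any radius the limit condition makes the terms at most 1 beyond some index; the
  finitely many earlier ones are absorbed into \<open>C\<close> through their sum.\<close>

lemma in_E_bounded_by:
  assumes "in_E q T nv f" "R > 0"
  shows "\<exists>C. bounded_by f R C"
proof -
  have "(\<lambda>n. nv (fps_nth f n) powr (1 / real n)) \<longlonglongrightarrow> 0"
    using assms unfolding in_E_def by blast
  then have "\<forall>\<^sub>F n in sequentially. nv (fps_nth f n) powr (1 / real n) < 1 / R"
    using assms(2) by (intro order_tendstoD(2)) auto
  then obtain N where N: "\<And>n. n \<ge> N \<Longrightarrow> nv (fps_nth f n) powr (1 / real n) < 1 / R"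
    unfolding eventually_sequentially by blast
  define C where "C = 1 + (\<Sum>n\<le>N. nv (fps_nth f n) * R ^ n)"
  have nonneg: "nv (fps_nth f n) * R ^ n \<ge> 0" for n
    using nv_nonneg assms(2) by (intro mult_nonneg_nonneg) auto
  have "nv (fps_nth f n) * R ^ n \<le> C" for n
  proof (cases "n \<le> N")
    case True
    then have "nv (fps_nth f n) * R ^ n \<le> (\<Sum>n\<le>N. nv (fps_nth f n) * R ^ n)"
      using nonneg by (intro member_le_sum) auto
    then show ?thesis by (simp add: C_def)
  next
    case False
    then have "nv (fps_nth f n) = (nv (fps_nth f n) powr (1 / real n)) powr real n"
      using nv_nonneg by (simp add: powr_powr)
    also have "\<dots> \<le> (1 / R) powr real n"
      using N[of n] False by (intro powr_mono2) auto
    also have "\<dots> = 1 / R ^ n" using assms(2) by (simp add: powr_realpow power_divide)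
    finally have "nv (fps_nth f n) * R ^ n \<le> 1" using assms(2) by (simp add: field_simps)
    moreover have "(\<Sum>n\<le>N. nv (fps_nth f n) * R ^ n) \<ge> 0" using nonneg by (intro sum_nonneg) auto
    ultimately show ?thesis by (simp add: C_def)
  qed
  then show ?thesis unfolding bounded_by_def by blast
qed

lemma in_E_evals: "in_E q T nv f \<Longrightarrow> \<exists>s. evals f x s"
proof -
  assume f: "in_E q T nv f"
  have R: "nv x + 1 > 0" using nv_nonneg[of x] by linarith
  obtain C where "bounded_by f (nv x + 1) C" using in_E_bounded_by[OF f R] by blast
  from bounded_by_evals[OF this R] show ?thesis by simp
qed

lemma evals_series_eval: "evals f x s \<Longrightarrow> series_eval nv f x = s"
  unfolding series_eval_def using evals_unique by (intro the_equality) (auto simp: evals_def)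

text \<open>Up to sign and a power of \<open>x\<close>, the coefficients of the quotient are the partial sums of \<open>f\<close> at \<open>x\<close>,
  which equal minus the remainders because \<open>f\<close> vanishes there.\<close>

lemma divide_zero:
  assumes f: "bounded_by f R C" "R > 0" "nv x < R" and x: "x \<noteq> 0" "evals f x 0"
  shows "\<exists>g. f = fps_of_poly [:- x, 1:] * g \<and> bounded_by g R (C / R)"
proof -
  define l where "l = fps_of_poly [:- x, 1:]"
  have l: "l = fps_X - fps_const x" by (simp add: l_def fps_of_poly_pCons)
  define g where "g = inverse l * f"
  have "fps_nth l 0 \<noteq> 0" using x by (simp add: l)
  then have fg: "f = l * g" by (simp add: g_def mult.assoc[symmetric] inverse_mult_eq_1')
  have rec0: "fps_nth f 0 = - x * fps_nth g 0" by (simp add: fg l left_diff_distrib)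
  have rec: "fps_nth f (Suc n) = fps_nth g n - x * fps_nth g (Suc n)" for n
    by (simp add: fg l left_diff_distrib)
  have sums: "(\<Sum>m<Suc n. fps_nth f m * x ^ m) = - (x ^ Suc n * fps_nth g n)" for n
  proof (induction n)
    case (Suc n)
    show ?case unfolding sum.lessThan_Suc[of _ "Suc n"] Suc.IH rec by (simp add: algebra_simps)
  qed (simp add: rec0)
  have "nv (fps_nth g n) * R ^ n \<le> C / R" for n
  proof -
    define B where "B = C * (nv x / R) ^ Suc n"
    have "nv (x ^ Suc n * fps_nth g n) \<le> B"
    proof (rule LIMSEQ_le_const)
      show "(\<lambda>N. nv (0 - (\<Sum>m<N. fps_nth f m * x ^ m)) + B) \<longlonglongrightarrow> B"
        using tendsto_add[OF x(2)[unfolded evals_def] tendsto_const[of B]] by simp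
      show "\<exists>N. \<forall>k\<ge>N. nv (x ^ Suc n * fps_nth g n) \<le> nv (0 - (\<Sum>m<k. fps_nth f m * x ^ m)) + B"
      proof (intro exI allI impI)
        fix k assume k: "k \<ge> Suc n"
        have "x ^ Suc n * fps_nth g n
            = (0 - (\<Sum>m<k. fps_nth f m * x ^ m)) + (\<Sum>m\<in>{Suc n..<k}. fps_nth f m * x ^ m)"
          using lessThan_split[OF k, of "\<lambda>m. fps_nth f m * x ^ m"] sums[of n] by simp
        also have "nv \<dots> \<le> nv (0 - (\<Sum>m<k. fps_nth f m * x ^ m)) + B"
          using bounded_by_block[OF f(1,2), of x "Suc n" k] f(3) unfolding B_def
          by (intro order_trans[OF nv_triangle] add_left_mono) simp
        finally show "nv (x ^ Suc n * fps_nth g n) \<le> nv (0 - (\<Sum>m<k. fps_nth f m * x ^ m)) + B" .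
      qed
    qed
    then have "nv x ^ Suc n * (nv (fps_nth g n) * R ^ Suc n) \<le> nv x ^ Suc n * C"
      using f(2) unfolding B_def nv_mult nv_power power_divide by (simp add: field_simps)
    then have "nv (fps_nth g n) * R ^ Suc n \<le> C"
      using nv_pos[OF x(1)] by (simp only: mult_le_cancel_left_pos zero_less_power)
    then show ?thesis using f(2) by (simp add: field_simps)
  qed
  then show ?thesis using fg unfolding l_def bounded_by_def by blast
qed

text \<open>The remaining zeros pass to the quotient, since the linear factors already removed do
  not vanish there; each division gains a factor \<open>R\<close>.\<close>

lemma divide_zeros:
  assumes "finite S" "bounded_by f R C" "R > 0"
    and "\<And>x. x \<in> S \<Longrightarrow> x \<noteq> 0 \<and> nv x < R \<and> evals f x 0"
  shows "\<exists>g. f = fps_of_poly (\<Prod>x\<in>S. [:- x, 1:]) * g \<and> bounded_by g R (C / R ^ card S)"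
  using assms(1,4)
proof (induction S rule: finite_induct)
  case empty
  then show ?case using assms(2) by simp
next
  case (insert x S)
  then obtain g where g: "f = fps_of_poly (\<Prod>x\<in>S. [:- x, 1:]) * g" "bounded_by g R (C / R ^ card S)"
    by auto
  have x: "x \<noteq> 0" "nv x < R" "evals f x 0" using insert.prems by auto
  obtain t where t: "evals g x t" using bounded_by_evals[OF g(2) assms(3) x(2)] by blast
  have "evals f x (poly (\<Prod>x\<in>S. [:- x, 1:]) x * t)"
    unfolding g(1) by (rule evals_poly_mult[OF t])
  from evals_unique[OF this x(3)] have "poly (\<Prod>x\<in>S. [:- x, 1:]) x * t = 0" .
  moreover have "poly (\<Prod>x\<in>S. [:- x, 1:]) x \<noteq> 0"
    using insert.hyps by (auto simp: poly_prod)
  ultimately have "evals g x 0" using t by simp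
  from divide_zero[OF g(2) assms(3) x(2,1) this] obtain h
    where h: "g = fps_of_poly [:- x, 1:] * h" "bounded_by h R (C / R ^ card S / R)" by blast
  show ?case
  proof (intro exI conjI)
    show "f = fps_of_poly (\<Prod>x\<in>insert x S. [:- x, 1:]) * h"
      using g(1) h(1) insert.hyps by (simp add: fps_of_poly_mult mult_ac)
    show "bounded_by h R (C / R ^ card (insert x S))"
      using h(2) insert.hyps by (simp add: mult.commute)
  qed
qed

lemma schwarz:
  assumes S: "finite S" "bounded_by f R C" "R \<ge> 1"
    "\<And>x. x \<in> S \<Longrightarrow> x \<noteq> 0 \<and> nv x < R \<and> evals f x 0" and f: "f \<noteq> 0"
  shows "nv (fps_nth f (subdegree f)) * R ^ card S \<le> C * (\<Prod>x\<in>S. nv x)"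
proof -
  define P where "P = (\<Prod>x\<in>S. [:- x, 1:])"
  obtain g where g: "f = fps_of_poly P * g" "bounded_by g R (C / R ^ card S)"
    using divide_zeros[OF S(1,2) _ S(4)] S(3) unfolding P_def by auto
  define m where "m = subdegree f"
  have P0: "coeff P 0 = (\<Prod>x\<in>S. - x)"
    by (simp add: P_def poly_prod flip: poly_0_coeff_0)
  then have "coeff P 0 \<noteq> 0" using S(1,4) by auto
  then have "subdegree (fps_of_poly P) = 0" by (intro subdegree_eq_0) simp
  then have "fps_nth f m = coeff P 0 * fps_nth g m"
    using g f unfolding m_def by (metis add_0 fps_of_poly_nth mult_zero_left mult_zero_right nth_subdegree_mult subdegree_mult)
  moreover have "nv (coeff P 0) = (\<Prod>x\<in>S. nv x)"
    unfolding P0 using S(1) by (induction S rule: finite_induct) (auto simp: nv_mult)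
  ultimately have "nv (fps_nth f m) * R ^ card S = (nv (fps_nth g m) * R ^ card S) * (\<Prod>x\<in>S. nv x)"
    by (simp add: nv_mult)
  also have "\<dots> \<le> C * (\<Prod>x\<in>S. nv x)"
  proof (intro mult_right_mono prod_nonneg)
    have "nv (fps_nth g m) * 1 \<le> nv (fps_nth g m) * R ^ m"
      using S(3) nv_nonneg by (intro mult_left_mono) auto
    also have "\<dots> \<le> C / R ^ card S" using g(2) unfolding bounded_by_def by blast
    finally show "nv (fps_nth g m) * R ^ card S \<le> C" using S(3) by (simp add: field_simps)
  qed (auto simp: nv_nonneg)
  finally show ?thesis unfolding m_def .
qed

lemma degree_map_frob_inv: "degree (map_poly \<phi> P) \<le> degree P"
  by (rule degree_le) (simp add: coeff_map_poly coeff_eq_0)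

lemma bounded_by_poly_mult:
  assumes f: "bounded_by f R C" and R: "R \<ge> 1" and B: "B \<ge> 0"
    and P: "\<And>t. nv (coeff P t) \<le> B" "degree P \<le> D"
  shows "bounded_by (fps_of_poly P * f) R (B * R ^ D * C)"
  unfolding bounded_by_def
proof
  fix n
  have C: "C \<ge> 0" using f by (rule bounded_by_nonneg)
  have "nv (fps_nth (fps_of_poly P * f) n) \<le> B * R ^ D * C / R ^ n"
    unfolding fps_mult_nth
  proof (rule nv_sum_le)
    fix t assume t: "t \<in> {0..n}"
    show "nv (fps_nth (fps_of_poly P) t * fps_nth f (n - t)) \<le> B * R ^ D * C / R ^ n"
    proof (cases "t \<le> D")
      case True
      have "nv (fps_nth (fps_of_poly P) t * fps_nth f (n - t)) * R ^ n
          = (nv (coeff P t) * R ^ t) * (nv (fps_nth f (n - t)) * R ^ (n - t))"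
        using t by (simp add: nv_mult mult_ac flip: power_add)
      also have "\<dots> \<le> (B * R ^ D) * C"
        using f P(1) R B C True nv_nonneg power_increasing[of t D R] unfolding bounded_by_def
        by (intro mult_mono) auto
      finally show ?thesis using R by (simp add: field_simps)
    next
      case False
      then have "coeff P t = 0" using P(2) by (simp add: coeff_eq_0)
      then show ?thesis using R B C by simp
    qed
  qed (use R B C in auto)
  then show "nv (fps_nth (fps_of_poly P * f) n) * R ^ n \<le> B * R ^ D * C"
    using R by (simp add: field_simps)
qed

lemma bounded_by_sum:
  assumes "\<And>i. i \<in> A \<Longrightarrow> bounded_by (f i) R C" "C \<ge> 0" "R > 0"
  shows "bounded_by (\<Sum>i\<in>A. f i) R C"
  unfolding bounded_by_def
proof
  fix n
  have "nv (\<Sum>i\<in>A. fps_nth (f i) n) \<le> C / R ^ n"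
    using assms unfolding bounded_by_def by (intro nv_sum_le) (auto simp: field_simps)
  then show "nv (fps_nth (\<Sum>i\<in>A. f i) n) * R ^ n \<le> C"
    using assms(3) by (simp add: fps_sum_nth field_simps)
qed

lemma bounded_by_mono: "bounded_by f R C \<Longrightarrow> C \<le> C' \<Longrightarrow> bounded_by f R C'"
  unfolding bounded_by_def by (meson order_trans)

section \<open>The iterated q-th roots of T\<close>

definition \<tau> :: "nat \<Rightarrow> 'a" where "\<tau> v = (\<phi> ^^ v) T"

lemma \<tau>_0 [simp]: "\<tau> 0 = T" and \<tau>_Suc: "\<tau> (Suc v) = \<phi> (\<tau> v)"
  by (simp_all add: \<tau>_def)

lemma \<tau>_power: "\<tau> (u + v) ^ (q ^ v) = \<tau> u"
proof (induction v)
  case (Suc v)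
  have "\<tau> (u + Suc v) ^ (q ^ Suc v) = (\<tau> (Suc (u + v)) ^ q) ^ (q ^ v)"
    by (simp only: power_Suc power_mult add_Suc_right)
  then show ?case using Suc by (simp only: \<tau>_Suc frob_inv_pow)
qed simp

lemma \<tau>_nonzero: "\<tau> v \<noteq> 0"
  by (induction v) (auto simp: \<tau>_Suc T_nonzero)

lemma nv_\<tau>_le: "nv (\<tau> v) \<le> real q"
proof (induction v)
  case (Suc v)
  show ?case
  proof (rule ccontr)
    assume *: "\<not> nv (\<tau> (Suc v)) \<le> real q"
    have q: "1 \<le> q" "1 \<le> real q" using q_gt_1 by auto
    have "nv (\<tau> (Suc v)) ^ 1 \<le> nv (\<tau> (Suc v)) ^ q"
      using * q by (intro power_increasing) auto
    also have "\<dots> = nv (\<tau> v)" by (simp add: \<tau>_Suc nv_frob_inv)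
    finally show False using Suc * by simp
  qed
qed (simp add: nv_T)

text \<open>A coincidence would make \<open>T\<close> a fixed point of a positive power of
  Frobenius, against \<open>nv T > 1\<close>.\<close>

lemma \<tau>_inj: "inj \<tau>"
proof (rule linorder_injI)
  fix u v :: nat assume "u < v"
  then obtain k where v: "v = k + u" "k > 0" by (metis add.commute less_imp_add_positive)
  show "\<tau> u \<noteq> \<tau> v"
  proof
    assume "\<tau> u = \<tau> v"
    then have "\<tau> u ^ (q ^ u) = \<tau> v ^ (q ^ u)" by (simp only:)
    then have "T = \<tau> k" using \<tau>_power[of 0 u] \<tau>_power[of k u] by (simp add: v)
    then have "T ^ (q ^ k) = T" using \<tau>_power[of 0 k] by simp
    then have "real q ^ (q ^ k) = real q ^ 1" by (metis nv_T nv_power power_one_right)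
    then have "q ^ k = 1"
      using q_gt_1 power_inject_exp[of "real q" "q ^ k" 1] by (simp del: power_eq_1_iff)
    then show False using v(2) one_less_power[OF q_gt_1, of k] by simp
  qed
qed

lemma series_eval_evals: "in_E q T nv f \<Longrightarrow> evals f x (series_eval nv f x)"
  using in_E_evals evals_series_eval by metis

end

section \<open>The auxiliary function\<close>

text \<open>Clearing denominators turns the functional equation into an equation between
  \<open>\<Phi>\<psi>\<close> and \<open>\<gamma>\<close> times the inverse twist of \<open>\<psi>\<close>, with \<open>\<gamma>\<close> a nonzero polynomial in \<open>T\<close>.\<close>

locale abp = lattice p q T nv W h0
  for p q T and nv :: "'a::field \<Rightarrow> real" and W h0 +
  fixes \<Phi> :: "'n::finite \<Rightarrow> 'n \<Rightarrow> 'a poly" and \<psi> :: "'n \<Rightarrow> 'a fps" and \<rho> :: "'n \<Rightarrow> 'a"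
    and \<gamma> :: 'a and b e :: nat
  assumes \<gamma>_ge: "nv \<gamma> \<ge> 1"
    and sz_\<Phi>: "sz b (coeff (\<Phi> i j) n)" and deg_\<Phi>: "degree (\<Phi> i j) \<le> e"
    and sz_\<rho>: "sz b (\<rho> i)" and \<rho>_nonzero: "\<exists>i. \<rho> i \<noteq> 0"
    and det_root: "poly (det (\<chi> i j. \<Phi> i j)) x = 0 \<Longrightarrow> x = T"
    and \<psi>_E: "in_E q T nv (\<psi> i)"
    and functional: "(\<Sum>j\<in>UNIV. fps_of_poly (\<Phi> i j) * \<psi> j) = fps_const \<gamma> * twist_inv q (\<psi> i)"
    and relation: "(\<Sum>i\<in>UNIV. \<rho> i * series_eval nv (\<psi> i) T) = 0"
begin

definition Ev :: "('n \<Rightarrow> 'a poly) \<Rightarrow> 'a fps" where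
  "Ev P = (\<Sum>i\<in>UNIV. fps_of_poly (P i) * \<psi> i)"

text \<open>The row map from \<open>P\<close> to \<open>P^(-1) \<Phi>\<close>; by the functional
  equation it realises the inverse twist of \<open>Ev P\<close> up to the factor
  \<open>\<gamma>\<close>.\<close>

definition \<sigma> :: "('n \<Rightarrow> 'a poly) \<Rightarrow> 'n \<Rightarrow> 'a poly" where
  "\<sigma> P j = (\<Sum>i\<in>UNIV. map_poly \<phi> (P i) * \<Phi> i j)"

text \<open>The rule of \<open>\<sigma>\<close> on the level of values: if \<open>P\<close> has the
  value \<open>rel v\<close> at \<open>\<tau> v\<close>, then \<open>\<sigma> P\<close> has the
  value \<open>rel (Suc v)\<close> at \<open>\<tau> (Suc v)\<close>.\<close>

primrec rel :: "nat \<Rightarrow> 'n \<Rightarrow> 'a" where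
  "rel 0 = \<rho>"
| "rel (Suc v) = (\<lambda>j. \<Sum>i\<in>UNIV. \<phi> (rel v i) * poly (\<Phi> i j) (\<tau> (Suc v)))"

lemma \<gamma>_nonzero: "\<gamma> \<noteq> 0"
  using \<gamma>_ge by auto

lemma Ev_mult_\<Phi>:
  "(\<Sum>j\<in>UNIV. fps_of_poly (\<Sum>i\<in>UNIV. R i * \<Phi> i j) * \<psi> j)
     = fps_const \<gamma> * (\<Sum>i\<in>UNIV. fps_of_poly (R i) * twist_inv q (\<psi> i))"
proof -
  have "(\<Sum>j\<in>UNIV. fps_of_poly (\<Sum>i\<in>UNIV. R i * \<Phi> i j) * \<psi> j)
      = (\<Sum>j\<in>UNIV. \<Sum>i\<in>UNIV. fps_of_poly (R i) * (fps_of_poly (\<Phi> i j) * \<psi> j))"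
    by (simp add: fps_of_poly_sum fps_of_poly_mult sum_distrib_right mult.assoc)
  also have "\<dots> = (\<Sum>i\<in>UNIV. fps_of_poly (R i) * (\<Sum>j\<in>UNIV. fps_of_poly (\<Phi> i j) * \<psi> j))"
    by (subst sum.swap) (simp add: sum_distrib_left)
  also have "\<dots> = fps_const \<gamma> * (\<Sum>i\<in>UNIV. fps_of_poly (R i) * twist_inv q (\<psi> i))"
    unfolding functional by (simp add: sum_distrib_left mult.left_commute)
  finally show ?thesis .
qed

lemma twist_inv_Ev:
  "twist_inv q (Ev P) = (\<Sum>i\<in>UNIV. fps_of_poly (map_poly \<phi> (P i)) * twist_inv q (\<psi> i))"
  by (simp add: Ev_def twist_inv_sum twist_inv_mult twist_inv_of_poly)

lemma Ev_\<sigma>: "Ev (\<sigma> P) = fps_const \<gamma> * twist_inv q (Ev P)"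
  unfolding twist_inv_Ev Ev_mult_\<Phi>[symmetric] by (simp add: Ev_def \<sigma>_def)

text \<open>Inverse twisting costs nothing in size or degree, so each application adds only the
  bounds for \<open>\<Phi>\<close>.\<close>

lemma coeff_\<sigma>:
  assumes "\<And>i n. sz c (coeff (P i) n)" "\<And>i. degree (P i) \<le> d"
  shows "sz (c + b) (coeff (\<sigma> P j) n)" "degree (\<sigma> P j) \<le> d + e"
proof -
  show "sz (c + b) (coeff (\<sigma> P j) n)"
    unfolding \<sigma>_def coeff_sum coeff_mult
    by (intro sz_sum sz_mult sz_\<Phi>) (simp add: coeff_map_poly sz_frob_inv assms)
  show "degree (\<sigma> P j) \<le> d + e" unfolding \<sigma>_def
    by (intro degree_sum_le finite order_trans[OF degree_mult_le] add_mono deg_\<Phi>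
        order_trans[OF degree_map_frob_inv] assms)
qed

lemma coeff_\<sigma>_pow:
  assumes "\<And>i n. sz c (coeff (P i) n)" "\<And>i. degree (P i) \<le> d"
  shows "(\<forall>j n. sz (c + m * b) (coeff ((\<sigma> ^^ m) P j) n)) \<and> (\<forall>j. degree ((\<sigma> ^^ m) P j) \<le> d + m * e)"
proof (induction m)
  case (Suc m)
  then show ?case using coeff_\<sigma>[of "c + m * b" "(\<sigma> ^^ m) P" "d + m * e"]
    by (simp add: add_ac)
qed (simp add: assms)

lemma sz_\<tau>: "sz 1 (\<tau> v)"
  by (induction v) (auto simp: \<tau>_Suc intro: sz_frob_inv sz_AA simp del: One_nat_def)

text \<open>The growth is linear in \<open>v\<close> because every \<open>\<tau> v\<close> has size
  at most 1, however deep the root.\<close>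

lemma sz_rel: "sz (b + v * (b + e)) (rel v j)"
proof (induction v arbitrary: j)
  case (Suc v)
  have "sz (b + e) (poly (\<Phi> i j) (\<tau> (Suc v)))" for i
    unfolding poly_altdef
  proof (rule sz_sum)
    fix k assume "k \<in> {..degree (\<Phi> i j)}"
    then have "k \<le> e" using deg_\<Phi>[of i j] by simp
    moreover have "sz (b + k * 1) (coeff (\<Phi> i j) k * \<tau> (Suc v) ^ k)"
      by (intro sz_mult sz_power sz_\<Phi> sz_\<tau>)
    ultimately show "sz (b + e) (coeff (\<Phi> i j) k * \<tau> (Suc v) ^ k)"
      by (auto elim!: sz_mono)
  qed
  then have "sz (b + v * (b + e) + (b + e)) (rel (Suc v) j)"
    using Suc.IH by (auto intro!: sz_sum sz_mult sz_frob_inv)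
  then show ?case by (simp add: algebra_simps)
qed (simp add: sz_\<rho>)

section \<open>The determinant and the adjugate of the matrix\<close>

definition M :: "'a poly^'n^'n" where "M = (\<chi> i j. \<Phi> i j)"

text \<open>Injectivity of \<open>\<tau>\<close> separates these points from \<open>T\<close>, the
  only possible zero of the determinant.\<close>

lemma det_M_\<tau>: "poly (det M) (\<tau> (Suc v)) \<noteq> 0"
  using det_root[of "\<tau> (Suc v)"] \<tau>_inj unfolding M_def inj_def by (metis \<tau>_0 nat.distinct(1))

lemma det_M_nonzero: "det M \<noteq> 0"
  using det_M_\<tau>[of 0] by auto

lemma \<Phi>_adjugate: "(\<Sum>j\<in>UNIV. \<Phi> i j * adjugate M $ j $ k) = (if i = k then det M else 0)"
  using arg_cong[OF matrix_mul_adjugate[of M], of "\<lambda>A. A $ i $ k"]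
  by (simp add: matrix_matrix_mult_def M_def mat_def)

lemma adjugate_\<Phi>: "(\<Sum>j\<in>UNIV. adjugate M $ i $ j * \<Phi> j k) = (if i = k then det M else 0)"
  using arg_cong[OF adjugate_matrix_mul[OF det_M_nonzero], of "\<lambda>A. A $ i $ k"]
  by (simp add: matrix_matrix_mult_def M_def mat_def)

text \<open>The recursion for \<open>rel\<close> solved for the earlier row, up to a nonzero scalar;
  it serves both the non-vanishing of the rows and the descent.\<close>

lemma rel_adjugate:
  "(\<Sum>k\<in>UNIV. rel (Suc v) k * poly (adjugate M $ k $ i) (\<tau> (Suc v)))
     = \<phi> (rel v i) * poly (det M) (\<tau> (Suc v))"
proof -
  let ?x = "\<tau> (Suc v)"
  have "(\<Sum>k\<in>UNIV. rel (Suc v) k * poly (adjugate M $ k $ i) ?x)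
      = (\<Sum>k\<in>UNIV. \<Sum>l\<in>UNIV. \<phi> (rel v l) * (poly (\<Phi> l k) ?x * poly (adjugate M $ k $ i) ?x))"
    by (simp add: sum_distrib_right mult.assoc)
  also have "\<dots> = (\<Sum>l\<in>UNIV. \<phi> (rel v l) * poly (\<Sum>k\<in>UNIV. \<Phi> l k * adjugate M $ k $ i) ?x)"
    by (subst sum.swap) (simp add: sum_distrib_left poly_sum)
  also have "\<dots> = \<phi> (rel v i) * poly (det M) ?x"
    unfolding \<Phi>_adjugate by (simp add: if_distrib[of "\<lambda>r. poly r _"] if_distrib[of "\<lambda>r. _ * r"] cong: if_cong)
  finally show ?thesis .
qed

lemma rel_nonzero: "\<exists>i. rel v i \<noteq> 0"
proof (induction v)
  case (Suc v)
  then obtain i where "rel v i \<noteq> 0" by blast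
  then have *: "\<phi> (rel v i) * poly (det M) (\<tau> (Suc v)) \<noteq> 0" using det_M_\<tau> by simp
  show ?case
  proof (rule ccontr)
    assume "\<not> (\<exists>i. rel (Suc v) i \<noteq> 0)"
    then have "(\<Sum>k\<in>UNIV. rel (Suc v) k * poly (adjugate M $ k $ i) (\<tau> (Suc v))) = 0"
      by (intro sum.neutral) (simp del: rel.simps)
    with * show False unfolding rel_adjugate by blast
  qed
qed (simp add: \<rho>_nonzero)

definition val :: "nat \<Rightarrow> 'n \<Rightarrow> 'a" where
  "val v i = series_eval nv (\<psi> i) (\<tau> v)"

lemma evals_val: "evals (\<psi> i) (\<tau> v) (val v i)"
  unfolding val_def by (rule series_eval_evals[OF \<psi>_E])

lemma val_Suc: "(\<Sum>j\<in>UNIV. poly (\<Phi> i j) (\<tau> (Suc v)) * val (Suc v) j) = \<gamma> * \<phi> (val v i)"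
proof (rule evals_unique)
  show "evals (\<Sum>j\<in>UNIV. fps_of_poly (\<Phi> i j) * \<psi> j) (\<tau> (Suc v))
      (\<Sum>j\<in>UNIV. poly (\<Phi> i j) (\<tau> (Suc v)) * val (Suc v) j)"
    by (intro evals_sum evals_poly_mult evals_val)
  show "evals (\<Sum>j\<in>UNIV. fps_of_poly (\<Phi> i j) * \<psi> j) (\<tau> (Suc v)) (\<gamma> * \<phi> (val v i))"
    unfolding functional \<tau>_Suc by (intro evals_const_mult evals_twist_inv evals_val)
qed

lemma rel_val: "(\<Sum>i\<in>UNIV. rel v i * val v i) = 0"
proof (induction v)
  case (Suc v)
  have "(\<Sum>j\<in>UNIV. rel (Suc v) j * val (Suc v) j)
      = (\<Sum>j\<in>UNIV. \<Sum>i\<in>UNIV. \<phi> (rel v i) * (poly (\<Phi> i j) (\<tau> (Suc v)) * val (Suc v) j))"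
    by (simp add: sum_distrib_right mult.assoc)
  also have "\<dots> = (\<Sum>i\<in>UNIV. \<phi> (rel v i) * (\<gamma> * \<phi> (val v i)))"
    by (subst sum.swap) (simp only: val_Suc flip: sum_distrib_left)
  also have "\<dots> = \<gamma> * \<phi> (\<Sum>i\<in>UNIV. rel v i * val v i)"
    by (simp add: sum_distrib_left frob_inv_sum frob_inv_mult mult.left_commute)
  finally show ?case using Suc by simp
qed (use relation in \<open>simp add: val_def\<close>)

lemma Ev_vanishes:
  assumes "\<And>i. poly (P i) (\<tau> v) = c * rel v i"
  shows "evals (Ev P) (\<tau> v) 0"
proof -
  have "evals (Ev P) (\<tau> v) (\<Sum>i\<in>UNIV. poly (P i) (\<tau> v) * val v i)"
    unfolding Ev_def by (intro evals_sum evals_poly_mult evals_val)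
  also have "(\<Sum>i\<in>UNIV. poly (P i) (\<tau> v) * val v i) = c * (\<Sum>i\<in>UNIV. rel v i * val v i)"
    unfolding assms by (simp add: sum_distrib_left mult.assoc)
  finally show ?thesis by (simp add: rel_val)
qed

text \<open>With \<open>l = CARD('n)\<close>, proportionality to a nonzero row is
  \<open>l - 1\<close> linear conditions per point: \<open>2 * l * s * (l - 1)\<close> equations for
  \<open>l * (2 * l - 1) * s\<close> coefficients, a surplus of \<open>l * s\<close>. The ratio is
  bounded independently of \<open>s\<close>, and the entries have size linear in
  \<open>s\<close>.\<close>

lemma ex_auxiliary_polys:
  "\<exists>A. \<forall>s\<ge>1. \<exists>P :: 'n \<Rightarrow> 'a poly. (\<forall>i. degree (P i) < (2 * CARD('n) - 1) * s) \<and> (\<exists>i. P i \<noteq> 0) \<and>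
     (\<forall>i n. sz (A * s) (coeff (P i) n)) \<and>
     (\<forall>v < 2 * CARD('n) * s. \<exists>c. \<forall>i. poly (P i) (\<tau> v) = c * rel v i)"
proof -
  have l: "CARD('n) \<ge> 1" by (simp add: Suc_le_eq card_gt_0_iff)
  \<comment> \<open>For \<open>s \<ge> 1\<close> the entries have size at most
    \<open>(2 * CARD('n) * (1 + b + e) + b) * s\<close>; the outer factor
    \<open>2 * CARD('n)\<close> and the summand \<open>h0\<close> come from
    \<open>siegel\<close>.\<close>
  define A where "A = 2 * CARD('n) * (2 * CARD('n) * (1 + b + e) + b) + h0"
  have "\<forall>v. \<exists>i. rel v i \<noteq> 0" using rel_nonzero by blast
  then obtain k where k: "\<And>v. rel v (k v) \<noteq> 0" by metis
  show ?thesis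
  proof (intro exI[of _ A] allI impI)
    fix s :: nat assume s: "s \<ge> 1"
    define V where "V = 2 * CARD('n) * s"
    define D where "D = (2 * CARD('n) - 1) * s"
    define c where "c = D + b + V * (b + e)"
    define I where "I = Sigma {..<V} (\<lambda>v. UNIV - {k v})"
    define J where "J = (UNIV :: 'n set) \<times> {..<D}"
    \<comment> \<open>The 2 by 2 minor of \<open>P (\<tau> v)\<close> and \<open>rel v\<close> in
      the columns \<open>i\<close> and \<open>k v\<close>, where \<open>k v\<close> marks a nonzero
      entry of \<open>rel v\<close>.\<close>
    define a where "a = (\<lambda>(v, i) (j, m).
      (if j = i then \<tau> v ^ m * rel v (k v) else if j = k v then - (\<tau> v ^ m * rel v i) else 0))"
    obtain l' where l': "CARD('n) = Suc l'" using l by (metis Suc_le_D One_nat_def)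
    have cI: "card I = V * (CARD('n) - 1)"
      unfolding I_def by (subst card_SigmaI) (auto simp: card_Diff_singleton)
    have cJ: "card J = CARD('n) * D" by (simp add: J_def card_cartesian_product)
    have IJ: "card J = card I + CARD('n) * s"
      unfolding cI cJ V_def D_def l' by (simp add: algebra_simps)
    have "\<exists>y. (\<forall>j\<in>J. sz (2 * CARD('n) * c + h0) (y j)) \<and> (\<exists>j\<in>J. y j \<noteq> 0) \<and>
        (\<forall>i\<in>I. (\<Sum>j\<in>J. a i j * y j) = 0)"
    proof (rule siegel)
      show "finite I" "finite J" by (auto simp: I_def J_def)
      show "card I < card J" using IJ s l by simp
      have "card I = 2 * (CARD('n) - 1) * (CARD('n) * s)" unfolding cI V_def by simp
      also have "\<dots> \<le> 2 * CARD('n) * (CARD('n) * s)" by (intro mult_le_mono1) simp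
      also have "CARD('n) * s = card J - card I" unfolding IJ by simp
      finally show "card I \<le> 2 * CARD('n) * (card J - card I)" .
      fix x y assume x: "x \<in> I" and y: "y \<in> J"
      obtain v i where v: "x = (v, i)" "v < V" using x by (auto simp: I_def)
      obtain j m where m: "y = (j, m)" "m < D" using y by (auto simp: J_def)
      have "sz c (\<tau> v ^ m * rel v i)" for i
      proof (rule sz_mono)
        show "sz (m * 1 + (b + v * (b + e))) (\<tau> v ^ m * rel v i)"
          by (intro sz_mult sz_power sz_\<tau> sz_rel)
        have "v * (b + e) \<le> V * (b + e)" using v by (intro mult_le_mono1) simp
        then show "m * 1 + (b + v * (b + e)) \<le> c" using m unfolding c_def by linarith
      qed
      then show "sz c (a x y)" unfolding a_def v m by (auto intro: sz_uminus)
    qed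
    then obtain y where y: "\<forall>j\<in>J. sz (2 * CARD('n) * c + h0) (y j)" "\<exists>j\<in>J. y j \<noteq> 0"
      "\<forall>i\<in>I. (\<Sum>j\<in>J. a i j * y j) = 0" by blast
    define P where "P i = (\<Sum>m<D. monom (y (i, m)) m)" for i
    have cP: "coeff (P i) m = (if m < D then y (i, m) else 0)" for i m
      by (simp add: P_def coeff_sum)
    have Pv: "poly (P i) x = (\<Sum>m<D. x ^ m * y (i, m))" for i x
      by (simp add: P_def poly_sum poly_monom mult.commute)
    have D: "D > 0" using s l' by (simp add: D_def)
    show "\<exists>P :: 'n \<Rightarrow> 'a poly. (\<forall>i. degree (P i) < (2 * CARD('n) - 1) * s) \<and> (\<exists>i. P i \<noteq> 0) \<and>
     (\<forall>i n. sz (A * s) (coeff (P i) n)) \<and>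
     (\<forall>v < 2 * CARD('n) * s. \<exists>c. \<forall>i. poly (P i) (\<tau> v) = c * rel v i)"
    proof (intro exI[of _ P] conjI allI impI)
      fix i
      have "degree (P i) \<le> D - 1" using cP by (intro degree_le) auto
      then show "degree (P i) < (2 * CARD('n) - 1) * s" using D unfolding D_def by linarith
    next
      obtain i m where "(i, m) \<in> J" "y (i, m) \<noteq> 0" using y(2) by auto
      then have "coeff (P i) m \<noteq> 0" using cP by (simp add: J_def)
      then show "\<exists>i. P i \<noteq> 0" by (metis coeff_0)
    next
      fix i n
      have "D \<le> V" unfolding D_def V_def by (intro mult_le_mono1) simp
      moreover have bs: "b * 1 \<le> b * s" "h0 * 1 \<le> h0 * s" by (intro mult_le_mono2 s)+
      moreover have "V * (1 + b + e) = V + V * (b + e)" by (simp add: distrib_left)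
      ultimately have "c \<le> V * (1 + b + e) + b * s" unfolding c_def by linarith
      also have "\<dots> = (2 * CARD('n) * (1 + b + e) + b) * s" unfolding V_def by (simp only: algebra_simps)
      finally have "2 * CARD('n) * c + h0 \<le> 2 * CARD('n) * ((2 * CARD('n) * (1 + b + e) + b) * s) + h0 * s"
        using bs(2) by (intro add_mono mult_le_mono2) auto
      also have "\<dots> = A * s" unfolding A_def by (simp only: algebra_simps)
      finally have le: "2 * CARD('n) * c + h0 \<le> A * s" .
      show "sz (A * s) (coeff (P i) n)"
      proof (cases "n < D")
        case True
        then have "sz (2 * CARD('n) * c + h0) (coeff (P i) n)" using y(1) cP by (simp add: J_def)
        then show ?thesis using le by (rule sz_mono)
      qed (simp add: cP)
    next
      fix v assume v: "v < 2 * CARD('n) * s"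
      \<comment> \<open>This factor may be 0; a count of zeros later provides some \<open>v\<close>
        for which it is not.\<close>
      define c where "c = poly (P (k v)) (\<tau> v) / rel v (k v)"
      have "poly (P i) (\<tau> v) = c * rel v i" for i
      proof (cases "i = k v")
        case False
        then have "(v, i) \<in> I" using v by (simp add: I_def V_def)
        then have "0 = (\<Sum>j\<in>J. a (v, i) j * y j)" using y(3) by simp
        also have "\<dots> = (\<Sum>j\<in>UNIV. \<Sum>m<D. a (v, i) (j, m) * y (j, m))"
          unfolding J_def by (subst sum.cartesian_product) (simp only: case_prod_unfold prod.collapse)
        also have "\<dots> = (\<Sum>j\<in>UNIV. (if j = i then rel v (k v) * poly (P i) (\<tau> v) else 0)
            + (if j = k v then - (rel v i * poly (P (k v)) (\<tau> v)) else 0))"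
          using False by (intro sum.cong refl)
            (auto simp: a_def Pv sum_distrib_left sum_negf mult_ac)
        also have "\<dots> = rel v (k v) * poly (P i) (\<tau> v) - rel v i * poly (P (k v)) (\<tau> v)"
          by (simp add: sum.distrib)
        finally show ?thesis using k[of v] by (simp add: c_def field_simps)
      qed (use k in \<open>simp add: c_def\<close>)
      then show "\<exists>c. \<forall>i. poly (P i) (\<tau> v) = c * rel v i" by blast
    qed
  qed
qed

end

section \<open>Vanishing of the auxiliary function\<close>

text \<open>There are \<open>L + 1\<close> rows of length \<open>L\<close>. Degrees up to a multiple
  of \<open>L * Suc d\<close> fix the ratio of equations to surplus unknowns at
  \<open>2 * L + 1\<close>, so the size bound does not involve \<open>d\<close>.\<close>

lemma (in lattice) ex_poly_dependency:
  fixes Q :: "nat \<Rightarrow> 'n::finite \<Rightarrow> 'a poly"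
  defines "L \<equiv> CARD('n)"
  assumes Q: "\<And>i j n. i \<le> L \<Longrightarrow> sz c (coeff (Q i j) n)" "\<And>i j. i \<le> L \<Longrightarrow> degree (Q i j) \<le> d"
  shows "\<exists>a. (\<forall>i n. sz ((2 * L + 1) * c + h0) (coeff (a i) n)) \<and> (\<exists>i\<le>L. a i \<noteq> 0) \<and>
    (\<forall>j. (\<Sum>i\<le>L. a i * Q i j) = 0)"
proof -
  define D where "D = 2 * L * Suc d"
  \<comment> \<open>The products have degree below \<open>D + d\<close>, so one index is spare; it
    makes \<open>card I\<close> an exact multiple of \<open>L * Suc d\<close>.\<close>
  define I where "I = (UNIV :: 'n set) \<times> {..<D + Suc d}"
  define J where "J = {..L} \<times> {..<D}"
  define b where "b = (\<lambda>(j, l) (i, k). coeff (Q i j * monom 1 k) l)"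
  have cI: "card I = (2 * L + 1) * (L * Suc d)"
    by (simp add: I_def card_cartesian_product D_def L_def[symmetric] algebra_simps)
  have cJ: "card J = card I + L * Suc d"
    unfolding cI by (simp add: J_def card_cartesian_product D_def algebra_simps)
  have L: "L > 0" by (simp add: L_def card_gt_0_iff)
  have "\<exists>y. (\<forall>j\<in>J. sz ((2 * L + 1) * c + h0) (y j)) \<and> (\<exists>j\<in>J. y j \<noteq> 0) \<and>
      (\<forall>i\<in>I. (\<Sum>j\<in>J. b i j * y j) = 0)"
  proof (rule siegel)
    show "finite I" "finite J" by (simp_all add: I_def J_def)
    show "card I < card J" unfolding cJ using L by simp
    show "card I \<le> (2 * L + 1) * (card J - card I)" unfolding cJ by (simp add: cI)
    show "sz c (b i j)" if "i \<in> I" "j \<in> J" for i j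
      using that Q(1)
      by (auto simp: b_def J_def coeff_monom_mult mult.commute[of _ "monom _ _"] split: prod.splits)
  qed
  then obtain y where y: "\<forall>j\<in>J. sz ((2 * L + 1) * c + h0) (y j)" "\<exists>j\<in>J. y j \<noteq> 0"
    "\<forall>i\<in>I. (\<Sum>j\<in>J. b i j * y j) = 0" by blast
  \<comment> \<open>Zero beyond \<open>L\<close>, so that the size bound holds for every
    index.\<close>
  define a where "a i = (if i \<le> L then (\<Sum>k<D. monom (y (i, k)) k) else 0)" for i
  have ca: "coeff (a i) k = (if i \<le> L \<and> k < D then y (i, k) else 0)" for i k
    by (simp add: a_def coeff_sum)
  have "(\<Sum>i\<le>L. a i * Q i j) = 0" for j
  proof (rule poly_eqI)
    fix l
    show "coeff (\<Sum>i\<le>L. a i * Q i j) l = coeff 0 l"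
    proof (cases "l < D + Suc d")
      case True
      have "a i * Q i j = (\<Sum>k<D. smult (y (i, k)) (Q i j * monom 1 k))" if "i \<le> L" for i
      proof -
        have "monom (y (i, k)) k * Q i j = smult (y (i, k)) (Q i j * monom 1 k)" for k
          by (metis mult.commute mult_smult_left smult_monom mult.right_neutral)
        then show ?thesis using that by (simp add: a_def sum_distrib_right)
      qed
      then have "coeff (\<Sum>i\<le>L. a i * Q i j) l
          = (\<Sum>i\<le>L. \<Sum>k<D. coeff (Q i j * monom 1 k) l * y (i, k))"
        by (simp add: coeff_sum mult.commute)
      also have "\<dots> = (\<Sum>ik\<in>J. b (j, l) ik * y ik)"
        unfolding J_def by (subst sum.cartesian_product) (simp only: b_def case_prod_unfold prod.collapse fst_conv snd_conv)
      also have "\<dots> = 0" using y(3) True by (simp add: I_def)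
      finally show ?thesis by simp
    next
      case False
      have "coeff (a i * Q i j) l = 0" if "i \<le> L" for i
      proof (rule coeff_eq_0)
        have "degree (a i) \<le> D" using ca by (intro degree_le) auto
        with degree_mult_le[of "a i" "Q i j"] Q(2)[OF that, of j] False
        show "degree (a i * Q i j) < l" by linarith
      qed
      then show ?thesis by (simp add: coeff_sum)
    qed
  qed
  moreover have "\<exists>i\<le>L. a i \<noteq> 0"
  proof -
    obtain i k where "i \<le> L" "k < D" "y (i, k) \<noteq> 0" using y(2) by (auto simp: J_def)
    then have "coeff (a i) k \<noteq> 0" by (simp add: ca)
    then show ?thesis using \<open>i \<le> L\<close> by auto
  qed
  moreover have "sz ((2 * L + 1) * c + h0) (coeff (a i) n)" for i n
    unfolding ca using y(1) by (auto simp: J_def)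
  ultimately show ?thesis by blast
qed

text \<open>In the dominant balance of the relation, the term with the largest index carries the lowest
  power of \<open>u\<close>.\<close>

lemma (in function_field) frobenius_relation_bound:
  assumes x: "\<And>i. i \<le> L \<Longrightarrow> nv (x i) = g i * u ^ (q ^ (L - i))"
    and g: "\<And>i. i \<le> L \<Longrightarrow> 1 \<le> g i \<and> g i \<le> G" and u: "u > 0"
    and sum: "(\<Sum>i\<le>L. d i * x i) = 0" and d: "\<And>i. i \<le> L \<Longrightarrow> nv (d i) \<le> B" "\<exists>i\<le>L. d i \<noteq> 0"
  shows "\<exists>i\<le>L. d i \<noteq> 0 \<and> nv (d i) \<le> B * G * u"
proof (cases "u \<ge> 1")
  case True
  obtain i where i: "i \<le> L" "d i \<noteq> 0" using d(2) by blast
  have B: "0 \<le> B" using d(1)[OF i(1)] nv_nonneg[of "d i"] by linarith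
  have "1 * 1 \<le> G * u" using g[OF i(1)] True by (intro mult_mono) auto
  then have "B * 1 \<le> B * (G * u)" using B by (intro mult_left_mono) auto
  then show ?thesis using i d(1)[OF i(1)] by (intro exI[of _ i]) (auto simp: mult.assoc)
next
  case False
  define k where "k = Max {i. i \<le> L \<and> d i \<noteq> 0}"
  have fin: "finite {i. i \<le> L \<and> d i \<noteq> 0}" by simp
  have "k \<in> {i. i \<le> L \<and> d i \<noteq> 0}" unfolding k_def using d(2) by (intro Max_in fin) auto
  then have k: "k \<le> L" "d k \<noteq> 0" by auto
  have max: "d i = 0" if "i \<le> L" "k < i" for i
  proof (rule ccontr)
    assume "d i \<noteq> 0"
    then have "i \<le> k" unfolding k_def using that fin by (intro Max_ge) auto
    with that show False by simp
  qed
  have B: "0 \<le> B" using d(1)[OF k(1)] nv_nonneg[of "d k"] by linarith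
  have G: "0 \<le> G" using g[OF k(1)] by linarith
  define Q where "Q = q ^ (L - k)"
  have "d k * x k = - (\<Sum>i\<in>{..L} - {k}. d i * x i)"
    using sum sum.remove[of "{..L}" k "\<lambda>i. d i * x i"] k(1) by (simp add: eq_neg_iff_add_eq_0)
  then have "nv (d k * x k) = nv (\<Sum>i\<in>{..L} - {k}. d i * x i)" by (simp only: nv_uminus)
  also have "\<dots> \<le> B * (G * u ^ Suc Q)"
  proof (rule nv_sum_le)
    fix i assume i: "i \<in> {..L} - {k}"
    show "nv (d i * x i) \<le> B * (G * u ^ Suc Q)"
    proof (cases "i < k")
      case True
      \<comment> \<open>Distinct powers of \<open>q\<close> differ by at least 1, so every other
        term carries one more factor \<open>u\<close>, which survives division by
        \<open>u ^ Q\<close>.\<close>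
      have "Suc Q \<le> q ^ (L - i)"
        unfolding Q_def Suc_le_eq using True k(1) q_gt_1 by (intro power_strict_increasing) auto
      then have "u ^ (q ^ (L - i)) \<le> u ^ Suc Q"
        using u False by (intro power_decreasing) auto
      then have "nv (x i) \<le> G * u ^ Suc Q"
        using i x[of i] g[of i] u by (auto intro!: mult_mono simp del: power_Suc)
      then show ?thesis unfolding nv_mult using i d(1)[of i] B nv_nonneg by (intro mult_mono) auto
    next
      case False
      then have "d i = 0" using i max[of i] by auto
      then show ?thesis using B G u by simp
    qed
  qed (use B G u in auto)
  finally have "nv (d k) * g k * u ^ Q \<le> B * G * u * u ^ Q"
    using x[OF k(1)] by (simp add: nv_mult Q_def mult_ac)
  then have "nv (d k) * g k \<le> B * G * u" using u by simp
  moreover have "nv (d k) * 1 \<le> nv (d k) * g k"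
    using g[OF k(1)] nv_nonneg by (intro mult_left_mono) auto
  ultimately show ?thesis using k by (intro exI[of _ k]) auto
qed

context abp
begin

text \<open>Let \<open>w\<close> be the \<open>q ^ L\<close>-th root of the lowest coefficient, at
  index \<open>m\<close>. The coefficients at \<open>m\<close> of the series
  \<open>Ev ((\<sigma> ^^ i) P)\<close> are powers of \<open>w\<close> times bounded factors, so a
  dependency among these rows makes \<open>w\<close> a root of an additive polynomial. Neither
  \<open>K\<close> nor \<open>A\<close> depends on \<open>P\<close>, \<open>d\<close> or
  \<open>m\<close>.\<close>

lemma Ev_lower_bound:
  "\<exists>K>0. \<exists>A. \<forall>P c d. (\<forall>i n. sz c (coeff (P i) n)) \<longrightarrow> (\<forall>i. degree (P i) \<le> d) \<longrightarrow> Ev P \<noteq> 0 \<longrightarrow>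
     K \<le> real q ^ (A * c) * nv (fps_nth (Ev P) (subdegree (Ev P)))"
proof -
  define L where "L = CARD('n)"
  obtain \<kappa> where \<kappa>: "\<kappa> > 0" "\<And>b x. sz b x \<Longrightarrow> x \<noteq> 0 \<Longrightarrow> nv x * real q ^ (card W * b) \<ge> \<kappa>"
    using sz_liouville by blast
  define G where "G = nv \<gamma> ^ L"
  have G: "G \<ge> 1" unfolding G_def using \<gamma>_ge by simp
  \<comment> \<open>\<open>card W\<close> comes from the Liouville bound for one coefficient, the
    extra 1 from the upper bound for the others.\<close>
  define N where "N = card W + 1"
  define B0 where "B0 = (2 * L + 1) * (L * b) + h0"
  \<comment> \<open>The estimate is first obtained for \<open>w\<close>; the exponent
    \<open>q ^ L\<close> carries it to the coefficient itself.\<close>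
  define K where "K = (\<kappa> / (real q ^ (N * B0) * G)) ^ (q ^ L)"
  define A where "A = N * (2 * L + 1) * q ^ L"
  have "K > 0" using \<kappa>(1) G by (simp add: K_def)
  moreover have "K \<le> real q ^ (A * c) * nv (fps_nth (Ev P) (subdegree (Ev P)))"
    if P: "\<And>i n. sz c (coeff (P i) n)" "\<And>i. degree (P i) \<le> d" and nz: "Ev P \<noteq> 0" for P c d
  proof -
    define m where "m = subdegree (Ev P)"
    define Q where "Q i = (\<sigma> ^^ i) P" for i
    define x where "x i = fps_nth (Ev (Q i)) m" for i
    define \<beta> where "\<beta> = (2 * L + 1) * (c + L * b) + h0"
    have Q: "sz (c + L * b) (coeff (Q i j) n)" "degree (Q i j) \<le> d + L * e" if "i \<le> L" for i j n
    proof -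
      have *: "sz (c + i * b) (coeff (Q i j) n)" "degree (Q i j) \<le> d + i * e"
        using coeff_\<sigma>_pow[of c P d i] P unfolding Q_def by auto
      have le: "i * b \<le> L * b" "i * e \<le> L * e" by (intro mult_le_mono1 that)+
      show "sz (c + L * b) (coeff (Q i j) n)" by (rule sz_mono[OF *(1) add_left_mono[OF le(1)]])
      show "degree (Q i j) \<le> d + L * e" using *(2) le(2) by linarith
    qed
    obtain a where a: "\<And>i n. sz \<beta> (coeff (a i) n)" "\<exists>i\<le>L. a i \<noteq> 0"
      "\<And>j. (\<Sum>i\<le>L. a i * Q i j) = 0"
      using ex_poly_dependency[of "c + L * b" Q "d + L * e"] Q unfolding L_def \<beta>_def by blast
    have Ev_Suc: "Ev (Q (Suc i)) = fps_const \<gamma> * twist_inv q (Ev (Q i))" for i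
      by (simp add: Q_def Ev_\<sigma>)
    have Q0: "Q 0 = P" by (simp add: Q_def)
    have low: "fps_nth (Ev (Q i)) n = 0" if "n < m" for i n
    proof (induction i)
      case 0
      show ?case using that unfolding m_def Q0 by (rule nth_less_subdegree_zero)
    next
      case (Suc i)
      then show ?case by (simp only: Ev_Suc fps_mult_left_const_nth twist_inv_nth frob_inv_0 mult_zero_right)
    qed
    have x_Suc: "x (Suc i) = \<gamma> * \<phi> (x i)" for i unfolding x_def Ev_Suc by (simp only: fps_mult_left_const_nth twist_inv_nth)
    have x0: "x 0 \<noteq> 0" using nz unfolding x_def Q0 m_def by (rule nth_subdegree_nonzero)
    define w where "w = (\<phi> ^^ L) (x 0)"
    have wL: "w ^ (q ^ L) = x 0" unfolding w_def by (rule frob_inv_funpow)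
    then have w0: "w \<noteq> 0" using x0 by (auto simp: power_0_left)
    \<comment> \<open>Since \<open>nv \<gamma> \<ge> 1\<close>, the accumulated factors never drop
      below 1 under \<open>q\<close>-th roots.\<close>
    have x_form: "\<exists>g. 1 \<le> nv g \<and> nv g \<le> nv \<gamma> ^ i \<and> x i = g * w ^ (q ^ (L - i))" if "i \<le> L" for i
      using that
    proof (induction i)
      case 0
      show ?case by (rule exI[of _ 1]) (simp add: wL)
    next
      case (Suc i)
      then obtain g where g: "1 \<le> nv g" "nv g \<le> nv \<gamma> ^ i" "x i = g * w ^ (q ^ (L - i))" by auto
      have "w ^ (q ^ (L - i)) = (w ^ (q ^ (L - Suc i))) ^ q"
        using Suc.prems by (metis Suc_diff_Suc Suc_le_lessD power_Suc2 power_mult)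
      then have "x (Suc i) = \<gamma> * \<phi> g * w ^ (q ^ (L - Suc i))"
        unfolding x_Suc g(3) frob_inv_mult by (simp add: frob_inv_eqI)
      moreover have 1: "1 \<le> nv (\<phi> g)"
        unfolding nv_frob_inv_root using g(1) by simp
      moreover have "nv (\<phi> g) \<le> nv g"
        using power_increasing[of 1 q "nv (\<phi> g)"] 1 q_gt_1 by (simp add: nv_frob_inv)
      ultimately show ?case using g \<gamma>_ge mult_mono[of 1 "nv \<gamma>" 1 "nv (\<phi> g)"]
        by (intro exI[of _ "\<gamma> * \<phi> g"]) (auto simp: nv_mult intro!: mult_left_mono)
    qed
    then obtain g where g: "\<And>i. i \<le> L \<Longrightarrow> 1 \<le> nv (g i) \<and> nv (g i) \<le> nv \<gamma> ^ i \<and>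
        x i = g i * w ^ (q ^ (L - i))" by metis
    \<comment> \<open>The least index at which some \<open>a i\<close> has a nonzero coefficient: at
      index \<open>k0 + m\<close> only these coefficients, paired with the \<open>x i\<close>,
      contribute.\<close>
    define k0 where "k0 = (LEAST k. \<exists>i\<le>L. coeff (a i) k \<noteq> 0)"
    have "\<exists>k. \<exists>i\<le>L. coeff (a i) k \<noteq> 0" using a(2) by (metis leading_coeff_0_iff)
    then have k0: "\<exists>i\<le>L. coeff (a i) k0 \<noteq> 0" unfolding k0_def by (rule LeastI_ex)
    have k0_least: "coeff (a i) k = 0" if "k < k0" "i \<le> L" for i k
      using not_less_Least[OF that(1)[unfolded k0_def]] that(2) by blast
    have "(\<Sum>i\<le>L. fps_of_poly (a i) * Ev (Q i)) = (\<Sum>j\<in>UNIV. fps_of_poly (\<Sum>i\<le>L. a i * Q i j) * \<psi> j)"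
      unfolding Ev_def sum_distrib_left fps_of_poly_sum sum_distrib_right fps_of_poly_mult mult.assoc
      by (rule sum.swap)
    also have "\<dots> = 0" using a(3) by simp
    finally have "0 = (\<Sum>i\<le>L. fps_nth (fps_of_poly (a i) * Ev (Q i)) (k0 + m))"
      by (metis fps_sum_nth fps_zero_nth)
    also have "\<dots> = (\<Sum>i\<le>L. coeff (a i) k0 * x i)"
      unfolding x_def by (intro sum.cong refl nth_fps_of_poly_mult_lowest k0_least low) auto
    finally have sum0: "(\<Sum>i\<le>L. coeff (a i) k0 * x i) = 0" by simp
    have "\<exists>i\<le>L. coeff (a i) k0 \<noteq> 0 \<and> nv (coeff (a i) k0) \<le> real q ^ \<beta> * G * nv w"
    proof (rule frobenius_relation_bound[where x = x and g = "\<lambda>i. nv (g i)"])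
      fix i assume i: "i \<le> L"
      show "nv (x i) = nv (g i) * nv w ^ q ^ (L - i)" using g[OF i] by (metis nv_mult nv_power)
      have "nv \<gamma> ^ i \<le> G" unfolding G_def using i \<gamma>_ge by (intro power_increasing)
      then show "1 \<le> nv (g i) \<and> nv (g i) \<le> G" using g[OF i] by linarith
      show "nv (coeff (a i) k0) \<le> real q ^ \<beta>" by (rule nv_sz[OF a(1)])
    qed (use k0 sum0 nv_pos[OF w0] in auto)
    then obtain i where i: "coeff (a i) k0 \<noteq> 0" "nv (coeff (a i) k0) \<le> real q ^ \<beta> * G * nv w"
      by blast
    have "\<kappa> \<le> nv (coeff (a i) k0) * real q ^ (card W * \<beta>)" by (rule \<kappa>(2)[OF a(1) i(1)])
    also have "\<dots> \<le> (real q ^ \<beta> * G * nv w) * real q ^ (card W * \<beta>)"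
      using i(2) by (intro mult_right_mono) auto
    also have "\<dots> = real q ^ (N * \<beta>) * G * nv w" by (simp add: N_def power_add)
    also have "N * \<beta> = N * (2 * L + 1) * c + N * B0" by (simp add: \<beta>_def B0_def algebra_simps)
    also have "real q ^ (N * (2 * L + 1) * c + N * B0) * G * nv w
        = real q ^ (N * (2 * L + 1) * c) * nv w * (real q ^ (N * B0) * G)"
      by (simp only: power_add mult_ac)
    finally have "\<kappa> / (real q ^ (N * B0) * G) \<le> real q ^ (N * (2 * L + 1) * c) * nv w"
      using G q_gt_1 by (subst pos_divide_le_eq) (auto intro!: mult_pos_pos)
    then have "K \<le> (real q ^ (N * (2 * L + 1) * c) * nv w) ^ (q ^ L)"
      unfolding K_def using \<kappa>(1) G by (intro power_mono) auto
    also have "\<dots> = real q ^ (A * c) * nv (x 0)"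
      unfolding wL[symmetric] nv_power power_mult_distrib A_def
      by (simp only: power_mult[symmetric] mult_ac)
    finally show ?thesis unfolding x_def Q0 m_def .
  qed
  ultimately show ?thesis by blast
qed

text \<open>The order of choices matters: \<open>R\<close> depends on the growth rates
  \<open>A1\<close> and \<open>A\<close> only, \<open>C\<close> bounds \<open>\<psi>\<close> at
  radius \<open>R\<close>, and \<open>s\<close> is taken last to outweigh \<open>C\<close>.\<close>

lemma ex_annihilator:
  "\<exists>P v c. Ev P = 0 \<and> (\<forall>i. P i \<in> polys_over (kbar q T)) \<and> c \<noteq> 0 \<and>
     (\<forall>i. poly (P i) (\<tau> v) = c * rel v i)"
proof -
  define L where "L = CARD('n)"
  have L: "L > 0" by (simp add: L_def card_gt_0_iff)
  obtain A1 where A1: "\<And>s. s \<ge> 1 \<Longrightarrow> \<exists>P :: 'n \<Rightarrow> 'a poly. (\<forall>i. degree (P i) < (2 * L - 1) * s) \<and>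
     (\<exists>i. P i \<noteq> 0) \<and> (\<forall>i n. sz (A1 * s) (coeff (P i) n)) \<and>
     (\<forall>v < 2 * L * s. \<exists>c. \<forall>i. poly (P i) (\<tau> v) = c * rel v i)"
    using ex_auxiliary_polys unfolding L_def by blast
  obtain K A where K: "K > 0" and A: "\<And>P c d. (\<And>i n. sz c (coeff (P i) n)) \<Longrightarrow>
     (\<And>i. degree (P i) \<le> d) \<Longrightarrow> Ev P \<noteq> 0 \<Longrightarrow>
     K \<le> real q ^ (A * c) * nv (fps_nth (Ev P) (subdegree (Ev P)))"
    using Ev_lower_bound by metis
  \<comment> \<open>\<open>A * A1\<close> pays for the lower bound, \<open>A1\<close> for the size
    of \<open>P\<close>, \<open>2 * L\<close> for a factor \<open>q\<close> at each of the
    \<open>2 * L * s\<close> zeros; the last 1 leaves the \<open>q ^ s\<close> that contradicts the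
    choice of \<open>s\<close>.\<close>
  define r where "r = A * A1 + A1 + 2 * L + 1"
  define R where "R = real q ^ r"
  have r2: "r \<ge> 2" using L by (simp add: r_def)
  have q1: "real q > 1" using q_gt_1 by simp
  have R1: "R \<ge> 1" unfolding R_def using q1 by simp
  have qR: "real q < R" unfolding R_def
    using power_strict_increasing[of 1 r "real q"] r2 q1 by simp
  obtain CC where CC: "\<And>i. bounded_by (\<psi> i) R (CC i)"
    using in_E_bounded_by[OF \<psi>_E] R1 by (metis less_le_trans zero_less_one)
  define C where "C = (\<Sum>i\<in>UNIV. CC i)"
  have CC0: "CC i \<ge> 0" for i using CC by (rule bounded_by_nonneg)
  have C: "bounded_by (\<psi> i) R C" for i
    unfolding C_def by (rule bounded_by_mono[OF CC]) (intro member_le_sum, auto simp: CC0)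
  have C0: "C \<ge> 0" unfolding C_def by (intro sum_nonneg CC0)
  obtain s where s: "s \<ge> 1" "C < K * real q ^ s"
  proof -
    obtain s where "C / K < real q ^ s" using real_arch_pow[OF q1] by blast
    also have "\<dots> \<le> real q ^ Suc s" using q1 by (intro power_increasing) auto
    finally show thesis using K by (intro that[of "Suc s"]) (auto simp: field_simps)
  qed
  define V where "V = 2 * L * s"
  define D where "D = (2 * L - 1) * s"
  obtain P :: "'n \<Rightarrow> 'a poly" where P: "\<And>i. degree (P i) < D" "\<exists>i. P i \<noteq> 0"
    "\<And>i n. sz (A1 * s) (coeff (P i) n)" "\<And>v. v < V \<Longrightarrow> \<exists>c. \<forall>i. poly (P i) (\<tau> v) = c * rel v i"
    using A1[OF s(1)] unfolding V_def D_def by blast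
  \<comment> \<open>Schwarz' lemma gains \<open>R ^ V\<close>, and the degree of \<open>P\<close>
    loses at most \<open>R ^ D\<close>.\<close>
  have VD: "V = D + s" using L unfolding V_def D_def by (cases L) (auto simp: algebra_simps)
  have "Ev P = 0"
  proof (rule ccontr)
    assume nz: "Ev P \<noteq> 0"
    define y where "y = nv (fps_nth (Ev P) (subdegree (Ev P)))"
    define S where "S = \<tau> ` {..<V}"
    have cS: "card S = V" unfolding S_def using \<tau>_inj by (simp add: card_image inj_on_subset)
    have bd: "bounded_by (Ev P) R (real q ^ (A1 * s) * R ^ D * C)"
      unfolding Ev_def
      by (intro bounded_by_sum bounded_by_poly_mult C R1 nv_sz P)
        (use P(1) R1 C0 q1 in \<open>auto intro: less_imp_le\<close>)
    have zeros: "x \<noteq> 0 \<and> nv x < R \<and> evals (Ev P) x 0" if xS: "x \<in> S" for x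
    proof -
      obtain v where v: "x = \<tau> v" "v < V" using xS by (auto simp: S_def)
      obtain c where "\<And>i. poly (P i) (\<tau> v) = c * rel v i" using P(4)[OF v(2)] by blast
      from Ev_vanishes[OF this] show ?thesis
        using v(1) \<tau>_nonzero nv_\<tau>_le[of v] qR by auto
    qed
    have "finite S" by (simp add: S_def)
    from schwarz[OF this bd R1 zeros nz]
    have "y * R ^ V \<le> real q ^ (A1 * s) * R ^ D * C * (\<Prod>x\<in>S. nv x)"
      unfolding y_def cS .
    also have "\<dots> \<le> real q ^ (A1 * s) * R ^ D * C * real q ^ V"
    proof (intro mult_left_mono)
      have "(\<Prod>x\<in>S. nv x) \<le> (\<Prod>x\<in>S. real q)"
        by (intro prod_mono) (auto simp: S_def nv_nonneg nv_\<tau>_le)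
      then show "(\<Prod>x\<in>S. nv x) \<le> real q ^ V" by (simp add: cS)
    qed (use R1 C0 in auto)
    finally have "(y * R ^ s) * R ^ D \<le> (C * real q ^ (A1 * s + V)) * R ^ D"
      unfolding VD by (simp add: power_add mult_ac)
    then have y_le: "y * R ^ s \<le> C * real q ^ (A1 * s + V)"
      using R1 by (simp add: mult_le_cancel_right)
    have "K \<le> real q ^ (A * (A1 * s)) * y"
      unfolding y_def by (rule A[OF P(3) less_imp_le[OF P(1)] nz])
    then have "K * R ^ s \<le> real q ^ (A * (A1 * s)) * (y * R ^ s)"
      using R1 by (simp add: mult.assoc[symmetric])
    also have "\<dots> \<le> real q ^ (A * (A1 * s)) * (C * real q ^ (A1 * s + V))"
      using y_le by (intro mult_left_mono) auto
    also have "\<dots> = C * real q ^ ((A * A1 + A1 + 2 * L) * s)"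
      by (simp add: V_def power_add algebra_simps)
    finally have "(K * real q ^ s) * real q ^ ((A * A1 + A1 + 2 * L) * s)
        \<le> C * real q ^ ((A * A1 + A1 + 2 * L) * s)"
      by (simp add: R_def r_def power_add power_mult[symmetric] algebra_simps)
    then have "K * real q ^ s \<le> C" using q1 by (simp add: mult_le_cancel_right)
    with s(2) show False by simp
  qed
  obtain i0 where i0: "P i0 \<noteq> 0" using P(2) by blast
  have "\<exists>v<V. poly (P i0) (\<tau> v) \<noteq> 0"
  proof (rule ccontr)
    assume "\<not> ?thesis"
    then have "\<tau> ` {..<V} \<subseteq> {x. poly (P i0) x = 0}" by auto
    then have "card (\<tau> ` {..<V}) \<le> card {x. poly (P i0) x = 0}"
      using poly_roots_finite[OF i0] by (intro card_mono)
    also have "\<dots> \<le> degree (P i0)" using i0 by (rule card_poly_roots_bound)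
    also have "\<dots> < V" using P(1)[of i0] VD by simp
    finally show False using \<tau>_inj by (simp add: card_image inj_on_subset)
  qed
  then obtain v where v: "v < V" "poly (P i0) (\<tau> v) \<noteq> 0" by blast
  obtain c where c: "\<forall>i. poly (P i) (\<tau> v) = c * rel v i" using P(4)[OF v(1)] by blast
  with v(2) have "c \<noteq> 0" by auto
  moreover have "P i \<in> polys_over (kbar q T)" for i
    unfolding polys_over_def using P(3) sz_algebraic by blast
  ultimately show ?thesis using \<open>Ev P = 0\<close> c by blast
qed

section \<open>Descent to the point T\<close>

lemma adjugate_M_kbar: "adjugate M $ i $ j \<in> polys_over (kbar q T)"
proof (rule adjugate_polys_over[OF kbar_subfield])
  show "M $ i $ j \<in> polys_over (kbar q T)" for i j
    using sz_algebraic[OF sz_\<Phi>] by (simp add: M_def polys_over_def)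
qed

text \<open>\<open>\<sigma>\<close> is inverted up to \<open>det M\<close>: the row
  \<open>R\<close>, which is \<open>P\<close> times the adjugate, satisfies
  \<open>R \<Phi> = det M P\<close>, and its forward twist \<open>P'\<close> satisfies
  \<open>\<sigma> P' = det M P\<close>. Hence the twist of \<open>Ev P'\<close> vanishes. Forward
  twisting raises coefficients to \<open>q\<close>-th powers and so stays in
  \<open>kbar\<close>.\<close>

lemma annihilator_descent:
  assumes "Ev P = 0" "\<And>i. P i \<in> polys_over (kbar q T)" "c \<noteq> 0"
    "\<And>i. poly (P i) (\<tau> (Suc v)) = c * rel (Suc v) i"
  shows "\<exists>P' c'. Ev P' = 0 \<and> (\<forall>i. P' i \<in> polys_over (kbar q T)) \<and> c' \<noteq> 0 \<and>
     (\<forall>i. poly (P' i) (\<tau> v) = c' * rel v i)"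
proof -
  define R where "R i = (\<Sum>k\<in>UNIV. P k * adjugate M $ k $ i)" for i
  define P' where "P' i = map_poly (\<lambda>x. x ^ q) (R i)" for i
  have RP': "map_poly \<phi> (P' i) = R i" for i
    unfolding P'_def
    by (rule poly_eqI) (simp add: coeff_map_poly power_0_left frob_inv_eqI)
  have R\<Phi>: "(\<Sum>i\<in>UNIV. R i * \<Phi> i j) = det M * P j" for j
  proof -
    have "(\<Sum>i\<in>UNIV. R i * \<Phi> i j) = (\<Sum>k\<in>UNIV. P k * (\<Sum>i\<in>UNIV. adjugate M $ k $ i * \<Phi> i j))"
      unfolding R_def sum_distrib_right sum_distrib_left mult.assoc by (rule sum.swap)
    also have "\<dots> = det M * P j" unfolding adjugate_\<Phi>
      by (simp add: if_distrib[of "\<lambda>r. _ * r"] mult.commute cong: if_cong)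
    finally show ?thesis .
  qed
  have "fps_const \<gamma> * twist_inv q (Ev P') = (\<Sum>j\<in>UNIV. fps_of_poly (det M * P j) * \<psi> j)"
    unfolding R\<Phi>[symmetric] Ev_mult_\<Phi> twist_inv_Ev RP' ..
  also have "\<dots> = fps_of_poly (det M) * Ev P"
    by (simp add: Ev_def fps_of_poly_mult sum_distrib_left mult.assoc)
  finally have "Ev P' = 0" using assms(1) \<gamma>_nonzero by simp
  moreover have "P' i \<in> polys_over (kbar q T)" for i
  proof -
    have "R i \<in> polys_over (kbar q T)"
      unfolding R_def by (intro polys_over_closed[OF kbar_subfield] assms(2) adjugate_M_kbar)
    then show ?thesis unfolding P'_def polys_over_def
      by (auto simp: coeff_map_poly power_0_left intro: subfield_closed(3)[OF kbar_subfield])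
  qed
  moreover have "poly (P' i) (\<tau> v) = (c * poly (det M) (\<tau> (Suc v))) ^ q * rel v i" for i
  proof -
    have "\<phi> (poly (P' i) (\<tau> v)) = poly (R i) (\<tau> (Suc v))"
      unfolding RP'[symmetric] \<tau>_Suc by (rule poly_map_frob_inv[symmetric])
    also have "\<dots> = c * (\<Sum>k\<in>UNIV. rel (Suc v) k * poly (adjugate M $ k $ i) (\<tau> (Suc v)))"
      unfolding R_def poly_sum poly_mult assms(4) by (simp only: sum_distrib_left mult.assoc)
    also have "\<dots> = c * poly (det M) (\<tau> (Suc v)) * \<phi> (rel v i)"
      unfolding rel_adjugate by (simp add: mult_ac)
    finally show ?thesis by (metis frob_inv_pow power_mult_distrib)
  qed
  moreover have "(c * poly (det M) (\<tau> (Suc v))) ^ q \<noteq> 0"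
    using assms(3) det_M_\<tau> by simp
  ultimately show ?thesis by blast
qed

lemma ex_lifted_relation:
  "\<exists>P. Ev P = 0 \<and> (\<forall>i. P i \<in> polys_over (kbar q T)) \<and> (\<forall>i. poly (P i) T = \<rho> i)"
proof -
  have descend: "\<exists>P c. Ev P = 0 \<and> (\<forall>i. P i \<in> polys_over (kbar q T)) \<and> c \<noteq> 0 \<and>
      (\<forall>i. poly (P i) (\<tau> 0) = c * rel 0 i)"
    if "Ev P = 0" "\<forall>i. P i \<in> polys_over (kbar q T)" "c \<noteq> 0"
      "\<forall>i. poly (P i) (\<tau> v) = c * rel v i" for P v c
    using that
  proof (induction v arbitrary: P c)
    case (Suc v)
    from Suc.prems obtain P' c' where "Ev P' = 0" "\<forall>i. P' i \<in> polys_over (kbar q T)" "c' \<noteq> 0"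
      "\<forall>i. poly (P' i) (\<tau> v) = c' * rel v i"
      using annihilator_descent[of P c v] by blast
    then show ?case by (rule Suc.IH)
  qed blast
  obtain P0 v c0 where "Ev P0 = 0" "\<forall>i. P0 i \<in> polys_over (kbar q T)" "c0 \<noteq> 0"
      "\<forall>i. poly (P0 i) (\<tau> v) = c0 * rel v i"
    using ex_annihilator by blast
  from descend[OF this] obtain P c where P: "Ev P = 0" "\<And>i. P i \<in> polys_over (kbar q T)" "c \<noteq> 0"
      "\<And>i. poly (P i) T = c * \<rho> i"
    unfolding rel.simps \<tau>_0 by blast
  obtain i where i: "\<rho> i \<noteq> 0" using \<rho>_nonzero by blast
  note kb = is_subfieldD[OF kbar_subfield] subfield_closed[OF kbar_subfield]
  have "T \<in> kbar q T" by (intro sz_algebraic[of 1] sz_AA AA_T)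
  \<comment> \<open>The scalar \<open>c\<close> is read off at a nonzero entry of
    \<open>\<rho>\<close>, so dividing by it keeps the coefficients in \<open>kbar\<close>.\<close>
  then have "poly (P i) T / \<rho> i \<in> kbar q T"
    by (intro kb polys_over_closed[OF kbar_subfield] P sz_algebraic[OF sz_\<rho>])
  then have "c \<in> kbar q T" using i P(4)[of i] by simp
  then have "inverse c \<in> kbar q T" by (rule kb)
  then have "smult (inverse c) (P i) \<in> polys_over (kbar q T)" for i
    by (intro polys_over_closed[OF kbar_subfield] P)
  moreover have "Ev (\<lambda>i. smult (inverse c) (P i)) = fps_const (inverse c) * Ev P"
    by (simp add: Ev_def fps_of_poly_smult sum_distrib_left mult.assoc)
  moreover have "poly (smult (inverse c) (P i)) T = \<rho> i" for i using P(3,4) by simp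
  ultimately show ?thesis using P(1) by (intro exI[of _ "\<lambda>i. smult (inverse c) (P i)"]) simp
qed

end

theorem theorem3p1:
  fixes p q :: nat and T :: "'a::field" and nv :: "'a \<Rightarrow> real"
    and \<Phi> :: "'a poly ^ 'n ^ 'n" and \<psi> :: "'a fps ^ 'n" and \<rho> :: "'a ^ 'n"
  assumes char: "prime p" "of_nat p = (0::'a)"
    and qpow: "\<exists>e\<ge>1. q = p ^ e"
    and nv_nonneg: "\<forall>x. nv x \<ge> 0"
    and nv_zero: "\<forall>x. nv x = 0 \<longleftrightarrow> x = 0"
    and nv_mult: "\<forall>x y. nv (x * y) = nv x * nv y"
    and nv_ultra: "\<forall>x y. nv (x + y) \<le> max (nv x) (nv y)"
    and nv_T: "nv T = real q"
    and complete: "\<forall>X::nat \<Rightarrow> 'a. (\<forall>e>0. \<exists>N. \<forall>m\<ge>N. \<forall>n\<ge>N. nv (X m - X n) < e)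
                      \<longrightarrow> (\<exists>L. (\<lambda>n. nv (X n - L)) \<longlonglongrightarrow> 0)"
    and alg_closed: "\<forall>f::'a poly. degree f \<ge> 1 \<longrightarrow> (\<exists>x. poly f x = 0)"
    and dense: "\<forall>x. \<forall>e>0. \<exists>y. algebraic_over (kinf q T nv) y \<and> nv (x - y) < e"
    and Phi_coeffs: "\<forall>i j n. coeff (\<Phi> $ i $ j) n \<in> kbar q T"
    and det_roots: "\<forall>x. poly (det \<Phi>) x = 0 \<longrightarrow> x = T"
    and psi_E: "\<forall>i. in_E q T nv (\<psi> $ i)"
    and functional_eq: "(\<chi> i. twist_inv q (\<psi> $ i)) = (\<chi> i j. fps_of_poly (\<Phi> $ i $ j)) *v \<psi>"
    and rho_kbar: "\<forall>i. \<rho> $ i \<in> kbar q T"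
    and rho_rel: "(\<Sum>i\<in>UNIV. \<rho> $ i * series_eval nv (\<psi> $ i) T) = 0"
  shows "\<exists>P :: 'a poly ^ 'n.
           (\<forall>i n. coeff (P $ i) n \<in> kbar q T)
         \<and> (\<chi> i. poly (P $ i) T) = \<rho>
         \<and> (\<Sum>i\<in>UNIV. fps_of_poly (P $ i) * \<psi> $ i) = 0"
proof -
  have field: "function_field p q T nv"
    by (rule function_field.intro[OF char qpow nv_nonneg[rule_format] nv_zero[rule_format]
          nv_mult[rule_format] nv_ultra[rule_format] nv_T complete alg_closed])
  show ?thesis
  \<comment> \<open>The construction starts from a nonzero row; the zero row is lifted by
    zero.\<close>
  proof (cases "\<rho> = 0")
    case True
    have "0 \<in> kbar q T" by (rule is_subfieldD(1)[OF function_field.kbar_subfield[OF field]])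
    then show ?thesis
      using True by (intro exI[of _ 0]) (simp add: vec_eq_iff)
  next
    case False
    interpret function_field p q T nv by (rule field)
    define X where "X = (\<Union>i. \<Union>j. coeff (\<Phi> $ i $ j) ` {..degree (\<Phi> $ i $ j)}) \<union> range (($) \<rho>)"
    have "finite X" by (simp add: X_def)
    moreover have "X \<subseteq> kbar q T" using Phi_coeffs rho_kbar by (auto simp: X_def)
    ultimately obtain W a h where W: "finite W" "W \<noteq> {}" "indep W" "\<forall>w\<in>W. acts W h w"
      and a: "a \<in> AA h" "a \<noteq> 0" "\<forall>y\<in>X. acts W h (a * y)"
      using ex_lattice[of X] by metis
    interpret lattice p q T nv W h
      by (intro lattice.intro field lattice_axioms.intro W(1-3) W(4)[rule_format])
    \<comment> \<open>Scaling \<open>\<Phi>\<close> and \<open>\<rho>\<close> by \<open>a\<close>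
      makes their entries act on the lattice; the functional equation thereby acquires the factor
      \<open>\<gamma> = a\<close>.\<close>
    define \<Phi>' where "\<Phi>' i j = smult a (\<Phi> $ i $ j)" for i j
    define e where "e = (\<Sum>i\<in>UNIV. \<Sum>j\<in>UNIV. degree (\<Phi> $ i $ j))"
    have deg: "degree (\<Phi> $ i $ j) \<le> e" for i j
    proof -
      have "degree (\<Phi> $ i $ j) \<le> (\<Sum>j\<in>UNIV. degree (\<Phi> $ i $ j))"
        by (intro member_le_sum) auto
      also have "\<dots> \<le> e" unfolding e_def
        by (rule member_le_sum[of i UNIV "\<lambda>i. \<Sum>j\<in>UNIV. degree (\<Phi> $ i $ j)"]) auto
      finally show ?thesis .
    qed
    \<comment> \<open>The determinant changes by a nonzero constant, so its zeros stay the
      same.\<close>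
    have det': "det (\<chi> i j. \<Phi>' i j) = (\<Prod>i\<in>(UNIV :: 'n set). [:a:]) * det \<Phi>"
    proof -
      have "(\<chi> i j. \<Phi>' i j) = (\<chi> i. [:a:] *s (\<Phi> $ i))"
        by (simp add: vec_eq_iff \<Phi>'_def)
      then show ?thesis using det_rows_mul[of "\<lambda>_. [:a:]" "($) \<Phi>"] by simp
    qed
    interpret abp p q T nv W h \<Phi>' "($) \<psi>" "\<lambda>i. a * \<rho> $ i" a h e
    proof
      show "nv a \<ge> 1" using a(1,2) by (rule nv_AA_ge)
      show "sz h (coeff (\<Phi>' i j) n)" for i j n
      proof (cases "n \<le> degree (\<Phi> $ i $ j)")
        case True
        then have "coeff (\<Phi> $ i $ j) n \<in> X" by (auto simp: X_def)
        then show ?thesis using a(3) by (simp add: \<Phi>'_def sz_acts)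
      next
        case False
        then show ?thesis by (simp add: \<Phi>'_def coeff_eq_0)
      qed
      show "degree (\<Phi>' i j) \<le> e" for i j
        using deg[of i j] by (simp add: \<Phi>'_def a(2))
      show "sz h (a * \<rho> $ i)" for i using a(3) by (intro sz_acts) (simp add: X_def)
      show "\<exists>i. a * \<rho> $ i \<noteq> 0" using False a(2) by (simp add: vec_eq_iff)
      show "x = T" if "poly (det (\<chi> i j. \<Phi>' i j)) x = 0" for x
        using that det_roots a(2) unfolding det' by (simp add: poly_prod)
      show "in_E q T nv (\<psi> $ i)" for i using psi_E by blast
      show "(\<Sum>j\<in>UNIV. fps_of_poly (\<Phi>' i j) * \<psi> $ j) = fps_const a * twist_inv q (\<psi> $ i)" for i
      proof -
        have "twist_inv q (\<psi> $ i) = (\<Sum>j\<in>UNIV. fps_of_poly (\<Phi> $ i $ j) * \<psi> $ j)"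
          using arg_cong[OF functional_eq, of "\<lambda>v. v $ i"] by (simp add: matrix_vector_mult_def)
        then show ?thesis
          by (simp add: \<Phi>'_def fps_of_poly_smult sum_distrib_left mult.assoc)
      qed
      show "(\<Sum>i\<in>UNIV. a * \<rho> $ i * series_eval nv (\<psi> $ i) T) = 0"
        using rho_rel by (simp add: mult.assoc flip: sum_distrib_left)
    qed
    obtain P where P: "Ev P = 0" "\<And>i. P i \<in> polys_over (kbar q T)" "\<And>i. poly (P i) T = a * \<rho> $ i"
      using ex_lifted_relation by blast
    note kb = kbar_subfield
    have "inverse a \<in> kbar q T"
      by (intro is_subfieldD(6)[OF kb] sz_algebraic[OF sz_AA[OF a(1)]])
    then have "smult (inverse a) (P i) \<in> polys_over (kbar q T)" for i
      by (intro polys_over_closed(6)[OF kb] P)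
    moreover have "(\<Sum>i\<in>UNIV. fps_of_poly (smult (inverse a) (P i)) * \<psi> $ i) = fps_const (inverse a) * Ev P"
      by (simp add: Ev_def fps_of_poly_smult sum_distrib_left mult.assoc)
    ultimately show ?thesis
      using P(1,3) a(2)
      by (intro exI[of _ "\<chi> i. smult (inverse a) (P i)"]) (auto simp: vec_eq_iff polys_over_def)
  qed
qed

end
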